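(* Suppose that $\rho_1=1$ and that for each $m\in\{0,\dots,M-1\}$ there is a constant $q_m$ such that for every $k$, on $\{t=k,\,O=o_m\}$, $\frac1n Z_{k+n}^{k,m}\to q_m$ almost surely as $n\to\infty$. For $\epsilon>0$ define $$Q_\epsilon^{(k,m)}=\sup\Big\{n\in\mathbb{N}:\ \Big|\tfrac1n Z_{k+n-1}^{k,m}-q_m\Big|>\epsilon\Big\},$$ and assume that $$\sum_{k=1}^\infty\mathbb{P}(t=k)\,\mathbb{E}\big[Q_\epsilon^{(k,m)}\,\big|\,t=k\big]<\infty\qquad\text{for all }\epsilon>0\text{ and all }m\in\{0,\dots,M-1\}.$$ For $\alpha\in(0,1)$ let $\Delta_\alpha=\{T:\mathrm{PFA}(T)\le\alpha\}$ and $T_{\mathrm{RP}}=\inf\{n\in\mathbb{N}_0:\pi_{n,0}\le\alpha\}$. Then $T_{\mathrm{RP}}$ is first-order asymptotically optimal as $\alpha\to0$, i.e. $$\lim_{\alpha\to0}\frac{\inf_{T\in\Delta_\alpha}\mathrm{ADD}(T)}{\mathrm{ADD}(T_{\mathrm{RP}})}=1,$$ where $$\inf_{T\in\Delta_\alpha}\mathrm{ADD}(T)=\frac1M\sum_{m=0}^{M-1}\frac{|\log\alpha|}{q_m+|\log(1-\rho)|}\,(1+o(1)),$$ with $o(1)\to 0$ as $\alpha\to0$.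
   Context: Notation: $\mathbb{N}_0=\{0,1,2,\dots\}$, $\mathbb{N}=\{1,2,\dots\}$, $x^+=\max\{0,x\}$. Model. Let $\mathcal{S}\subset\mathbb{R}^2$ be a domain and $\mathcal{O}=\{o_0,\dots,o_{M-1}\}\subset\mathcal{S}$ a finite set of $M$ possible source locations. The source location $O$ is uniform on $\mathcal{O}$. The change point $t$ is independent of $O$ and geometric with parameter $\rho\in(0,1)$: $\mathbb{P}(t=m)=\rho(1-\rho)^m$, $m\in\mathbb{N}_0$. Let $R_n$ be the integer radius of the event at time $n$: $R_n=0$ for $n<t$, $R_t=1$, and after time $t$ the radius increases by one unit per time slot with probability $\rho_1\in(0,1]$ (otherwise it stays the same), until it reaches the finite maximum $\mathfrak{R}\in\mathbb{N}$, the smallest radius covering all of $\mathcal{S}$ from any source in $\mathcal{O}$, where it stays. When $\rho_1=1$ the growth is deterministic: $R_n=\min(n-t+1,\mathfrak{R})$ for $n\ge t$. Observations. At each time $n\in\mathbb{N}$ there is a known deterministic finite set $\mathcal{A}_n\subset\mathcal{S}$ of sensor locations, and the fusion center receives $\mathbf{X}_n=(X_n^{(a)})_{a\in\mathcal{A}_n}$ (realization $\mathbf{x}_n$). Given $O=o_m$ and $R_n=r$, the $X_n^{(a)}$ are independent across sensors and independent of all previous observations, with $X_n^{(a)}$ having known density $f_1^{(a,o_m)}$ if $\|a-o_m\|<r$ and known density $f_0$ otherwise. The information at time $n$ is $I_n=(\mathbf{X}_1,\dots,\mathbf{X}_n)$, with $I_0$ empty. Stopping times $T$ are with respect to the filtration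 generated by $(I_n)_{n\ge0}$. Performance measures: $\mathrm{ADD}(T)=\mathbb{E}[(T-t)^+]$ and $\mathrm{PFA}(T)=\mathbb{P}(T<t)$. The posterior no-change probability is $\pi_{n,0}=\mathbb{P}(R_n=0\mid I_n)=\mathbb{P}(t>n\mid I_n)$. Log-likelihood ratio (case $\rho_1=1$). Let $\eta(n,k,m)=\{a\in\mathcal{A}_n:\|a-o_m\|<n-k+1\}$ be the set of sensors observing the event at time $n$ if it started at time $k$ at $o_m$. Put $$f_{1,k,m}(\mathbf{x}_n)=\prod_{a\in\eta(n,k,m)}f_1^{(a,o_m)}(x_n^{(a)})\prod_{a\in\mathcal{A}_n\setminus\eta(n,k,m)}f_0(x_n^{(a)}),\qquad f_0(\mathbf{x}_n)=\prod_{a\in\mathcal{A}_n}f_0(x_n^{(a)}),$$ $$Z_n^{k,m}=\sum_{i=k}^{n}\log\frac{f_{1,k,m}(\mathbf{X}_i)}{f_0(\mathbf{X}_i)},\qquad k\le n.$$ Since observations start at time $1$, the term $i=0$ (when $k=0$) is absent. The supremum of the empty set in the definition of $Q_\epsilon^{(k,m)}$ is taken to be $0$. *)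

theory Defs
  imports "HOL-Probability.Probability"
begin

type_synonym point = "real ^ 2"

text \<open>
  Strictness matches the observation model, in which a sensor observes an event of radius \<open>r\<close>
  iff its distance to the source is strictly less than \<open>r\<close>.
\<close>

definition max_radius :: "point set \<Rightarrow> nat \<Rightarrow> (nat \<Rightarrow> point) \<Rightarrow> nat" where
  "max_radius S M src = (LEAST r. \<forall>m<M. \<forall>s\<in>S. norm (s - src m) < real r)"

definition is_pdf :: "(real \<Rightarrow> real) \<Rightarrow> bool" where
  "is_pdf f \<longleftrightarrow> f \<in> borel_measurable borel \<and> (\<forall>x. 0 \<le> f x) \<and> prob_space (density lborel f)"

definition history ::
  "'w measure \<Rightarrow> ('w \<Rightarrow> point) \<Rightarrow> ('w \<Rightarrow> nat) \<Rightarrow> (nat \<Rightarrow> 'w \<Rightarrow> nat)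
    \<Rightarrow> point \<Rightarrow> nat \<Rightarrow> nat \<Rightarrow> (nat \<Rightarrow> nat) \<Rightarrow> 'w set" where
  "history P Src t R x k n r = {\<omega> \<in> space P. Src \<omega> = x \<and> t \<omega> = k \<and> (\<forall>i\<le>n. R i \<omega> = r i)}"

text \<open>
  \<open>src 0, \<dots>, src (M - 1)\<close> are the possible source locations and \<open>Src\<close> is the random source; the
  event starts at time \<open>t\<close> and has radius \<open>R n\<close> at time \<open>n\<close>. \<open>X n a\<close> is the observation
  of the sensor at \<open>a\<close> at time \<open>n\<close>, only relevant for \<open>n \<ge> 1\<close> and \<open>a \<in> A n\<close>. Since source,
  change point and radii are discrete, conditioning on them is conditioning on events of positive
  probability. Boundedness of \<open>S\<close> is the existence of a finite covering radius.
\<close>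

locale event_model = prob_space P for P :: "'w measure" +
  fixes S :: "point set" and M :: nat and src :: "nat \<Rightarrow> point"
    and A :: "nat \<Rightarrow> point set"
    and f0 :: "real \<Rightarrow> real" and f1 :: "point \<Rightarrow> point \<Rightarrow> real \<Rightarrow> real"
    and \<rho> \<rho>1 :: real
    and Src :: "'w \<Rightarrow> point" and t :: "'w \<Rightarrow> nat" and R :: "nat \<Rightarrow> 'w \<Rightarrow> nat"
    and X :: "nat \<Rightarrow> point \<Rightarrow> 'w \<Rightarrow> real"
  assumes bounded_S: "bounded S"
    and M_pos: "1 \<le> M"
    and src_inj: "inj_on src {..<M}"
    and src_S: "src ` {..<M} \<subseteq> S"
    and sensors: "\<And>n. 1 \<le> n \<Longrightarrow> finite (A n) \<and> A n \<subseteq> S"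
    and pdf0: "is_pdf f0"
    and pdf1: "\<And>n a m. 1 \<le> n \<Longrightarrow> a \<in> A n \<Longrightarrow> m < M \<Longrightarrow> is_pdf (f1 a (src m))"
    and rho: "0 < \<rho>" "\<rho> < 1"
    and rho1: "0 < \<rho>1" "\<rho>1 \<le> 1"
    and Src_uniform: "\<And>m. m < M \<Longrightarrow> \<P>(\<omega> in P. Src \<omega> = src m) = 1 / real M"
    and t_geometric: "\<And>k. \<P>(\<omega> in P. t \<omega> = k) = \<rho> * (1 - \<rho>) ^ k"
    and Src_measurable: "Src \<in> borel_measurable P"
    and t_measurable: "t \<in> measurable P (count_space UNIV)"
    and Src_t_indep: "indep_set (sets (vimage_algebra (space P) Src borel))
      (sets (vimage_algebra (space P) t (count_space UNIV)))"
    and R_measurable: "\<And>n. R n \<in> measurable P (count_space UNIV)"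
    and X_measurable: "\<And>n a. 1 \<le> n \<Longrightarrow> a \<in> A n \<Longrightarrow> X n a \<in> borel_measurable P"
    and R_before: "\<And>n \<omega>. \<omega> \<in> space P \<Longrightarrow> n < t \<omega> \<Longrightarrow> R n \<omega> = 0"
    and R_start: "\<And>\<omega>. \<omega> \<in> space P \<Longrightarrow> R (t \<omega>) \<omega> = 1"
    and R_grow: "\<And>m k n r. m < M \<Longrightarrow> k \<le> n \<Longrightarrow> prob (history P Src t R (src m) k n r) > 0 \<Longrightarrow>
      r n < max_radius S M src \<Longrightarrow>
      \<P>(\<omega> in P. R (Suc n) \<omega> = Suc (r n) \<bar> \<omega> \<in> history P Src t R (src m) k n r) = \<rho>1 \<and>
      \<P>(\<omega> in P. R (Suc n) \<omega> = r n \<bar> \<omega> \<in> history P Src t R (src m) k n r) = 1 - \<rho>1"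
    and R_stay: "\<And>m k n r. m < M \<Longrightarrow> k \<le> n \<Longrightarrow> prob (history P Src t R (src m) k n r) > 0 \<Longrightarrow>
      r n = max_radius S M src \<Longrightarrow>
      \<P>(\<omega> in P. R (Suc n) \<omega> = r n \<bar> \<omega> \<in> history P Src t R (src m) k n r) = 1"
    and X_indep: "\<And>m k n r. m < M \<Longrightarrow> prob (history P Src t R (src m) k n r) > 0 \<Longrightarrow>
      prob_space.indep_vars (uniform_measure P (history P Src t R (src m) k n r))
        (\<lambda>_. borel) (\<lambda>(i, a). X i a) (SIGMA i:{1..n}. A i)"
    and X_density: "\<And>m k n r i a. m < M \<Longrightarrow> prob (history P Src t R (src m) k n r) > 0 \<Longrightarrow>
      i \<in> {1..n} \<Longrightarrow> a \<in> A i \<Longrightarrow>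
      distributed (uniform_measure P (history P Src t R (src m) k n r)) lborel (X i a)
        (\<lambda>x. ennreal (if norm (a - src m) < real (r i) then f1 a (src m) x else f0 x))"

text \<open>
  \<open>info P A X (enat n)\<close> is the \<open>\<sigma>\<close>-algebra generated by the observations up to time \<open>n\<close>. Indexing
  by \<^typ>\<open>enat\<close> makes the library's stopping times take values in \<open>{0, 1, 2, \<dots>, \<infinity>}\<close>; at
  index \<open>\<infinity>\<close> the stopping time condition is void.
\<close>

definition info ::
  "'w measure \<Rightarrow> (nat \<Rightarrow> point set) \<Rightarrow> (nat \<Rightarrow> point \<Rightarrow> 'w \<Rightarrow> real) \<Rightarrow> enat \<Rightarrow> 'w measure" where
  "info P A X n = sigma (space P)
     {X i a -` B \<inter> space P | i a B. 1 \<le> i \<and> enat i \<le> n \<and> a \<in> A i \<and> B \<in> sets borel}"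

text \<open>Subtraction on \<^typ>\<open>enat\<close> truncates at \<open>0\<close>, so it is the positive part.\<close>

definition ADD :: "'w measure \<Rightarrow> ('w \<Rightarrow> nat) \<Rightarrow> ('w \<Rightarrow> enat) \<Rightarrow> ennreal" where
  "ADD P t T = (\<integral>\<^sup>+\<omega>. ennreal_of_enat (T \<omega> - enat (t \<omega>)) \<partial>P)"

definition PFA :: "'w measure \<Rightarrow> ('w \<Rightarrow> nat) \<Rightarrow> ('w \<Rightarrow> enat) \<Rightarrow> real" where
  "PFA P t T = \<P>(\<omega> in P. T \<omega> < enat (t \<omega>))"

definition Delta ::
  "'w measure \<Rightarrow> (nat \<Rightarrow> point set) \<Rightarrow> ('w \<Rightarrow> nat) \<Rightarrow> (nat \<Rightarrow> point \<Rightarrow> 'w \<Rightarrow> real)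
    \<Rightarrow> real \<Rightarrow> ('w \<Rightarrow> enat) set" where
  "Delta P A t X \<alpha> = {T. stopping_time (info P A X) T \<and> PFA P t T \<le> \<alpha>}"

definition post_no_change ::
  "'w measure \<Rightarrow> (nat \<Rightarrow> point set) \<Rightarrow> (nat \<Rightarrow> 'w \<Rightarrow> nat) \<Rightarrow> (nat \<Rightarrow> point \<Rightarrow> 'w \<Rightarrow> real)
    \<Rightarrow> nat \<Rightarrow> 'w \<Rightarrow> real" where
  "post_no_change P A R X n =
     real_cond_exp P (info P A X (enat n)) (indicator {\<omega> \<in> space P. R n \<omega> = 0})"

definition T_RP ::
  "'w measure \<Rightarrow> (nat \<Rightarrow> point set) \<Rightarrow> (nat \<Rightarrow> 'w \<Rightarrow> nat) \<Rightarrow> (nat \<Rightarrow> point \<Rightarrow> 'w \<Rightarrow> real)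
    \<Rightarrow> real \<Rightarrow> 'w \<Rightarrow> enat" where
  "T_RP P A R X \<alpha> \<omega> = Inf {enat n | n. post_no_change P A R X n \<omega> \<le> \<alpha>}"

text \<open>
  The densities are not assumed to be positive, so the log-likelihood ratio is extended real valued:
  \<open>log (c / 0) = \<infinity>\<close> and \<open>log (0 / c) = -\<infinity>\<close> for \<open>c > 0\<close>, and \<open>log (0 / 0) = 0\<close>.
\<close>

definition log_ratio :: "real \<Rightarrow> real \<Rightarrow> ereal" where
  "log_ratio x y =
     (if x = 0 \<and> y = 0 then 0 else if y = 0 then \<infinity> else if x = 0 then - \<infinity> else ereal (ln (x / y)))"

definition eta :: "(nat \<Rightarrow> point set) \<Rightarrow> (nat \<Rightarrow> point) \<Rightarrow> nat \<Rightarrow> nat \<Rightarrow> nat \<Rightarrow> point set" where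
  "eta A src n k m = {a \<in> A n. norm (a - src m) < real n - real k + 1}"

definition lik1 ::
  "(nat \<Rightarrow> point set) \<Rightarrow> (nat \<Rightarrow> point) \<Rightarrow> (real \<Rightarrow> real) \<Rightarrow> (point \<Rightarrow> point \<Rightarrow> real \<Rightarrow> real)
    \<Rightarrow> nat \<Rightarrow> nat \<Rightarrow> nat \<Rightarrow> (point \<Rightarrow> real) \<Rightarrow> real" where
  "lik1 A src f0 f1 k m n x =
     (\<Prod>a\<in>eta A src n k m. f1 a (src m) (x a)) * (\<Prod>a\<in>A n - eta A src n k m. f0 (x a))"

definition lik0 :: "(nat \<Rightarrow> point set) \<Rightarrow> (real \<Rightarrow> real) \<Rightarrow> nat \<Rightarrow> (point \<Rightarrow> real) \<Rightarrow> real" where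
  "lik0 A f0 n x = (\<Prod>a\<in>A n. f0 (x a))"

definition Z ::
  "(nat \<Rightarrow> point set) \<Rightarrow> (nat \<Rightarrow> point) \<Rightarrow> (real \<Rightarrow> real) \<Rightarrow> (point \<Rightarrow> point \<Rightarrow> real \<Rightarrow> real)
    \<Rightarrow> (nat \<Rightarrow> point \<Rightarrow> 'w \<Rightarrow> real) \<Rightarrow> nat \<Rightarrow> nat \<Rightarrow> nat \<Rightarrow> 'w \<Rightarrow> ereal" where
  "Z A src f0 f1 X k m n \<omega> =
     (\<Sum>i = max 1 k..n. log_ratio (lik1 A src f0 f1 k m i (\<lambda>a. X i a \<omega>)) (lik0 A f0 i (\<lambda>a. X i a \<omega>)))"

text \<open>On \<^typ>\<open>enat\<close> the supremum of the empty set is \<open>0\<close>.\<close>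

definition Q ::
  "(nat \<Rightarrow> point set) \<Rightarrow> (nat \<Rightarrow> point) \<Rightarrow> (real \<Rightarrow> real) \<Rightarrow> (point \<Rightarrow> point \<Rightarrow> real \<Rightarrow> real)
    \<Rightarrow> (nat \<Rightarrow> point \<Rightarrow> 'w \<Rightarrow> real) \<Rightarrow> (nat \<Rightarrow> real) \<Rightarrow> real \<Rightarrow> nat \<Rightarrow> nat \<Rightarrow> 'w \<Rightarrow> enat" where
  "Q A src f0 f1 X q \<epsilon> k m \<omega> =
     Sup {enat n | n. 1 \<le> n \<and>
       \<bar>Z A src f0 f1 X k m (k + n - 1) \<omega> / ereal (real n) - ereal (q m)\<bar> > ereal \<epsilon>}"

end

theory Submission
  imports Defs
begin

text \<open>
  Write \<open>d = \<bar>ln (1 - \<rho>)\<bar>\<close> and \<open>L = \<bar>ln \<alpha>\<bar>\<close>. Both optimality and the rate come from sandwiching: no procedure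
  with false alarm probability at most \<open>\<alpha>\<close> has a delay below \<open>L / (q m + d)\<close> on the event that
  the source is \<open>src m\<close>, to first order, and the posterior rule attains this.

  With \<open>\<rho>1 = 1\<close> the radii are a deterministic function of the change point, so the model reduces to
  the laws \<open>law k m\<close> of everything given change point \<open>k\<close> and source \<open>src m\<close>. Under each of them
  the observations are independent with explicit densities (\<open>distr_obs\<close>). Up to time \<open>n\<close>,
  all laws with change point beyond \<open>n\<close> agree, and they play the role of the no-change law. The
  log-likelihood ratio \<open>Z\<close> compares \<open>law k m\<close> with it: on events where \<open>Z \<le> c\<close>, the probability under
  \<open>law k m\<close> is at most \<open>exp c\<close> times that without change, and where \<open>Z \<ge> c\<close> it is at least
  \<open>exp c\<close> times that (\<open>change_le_no_change\<close>, \<open>no_change_le_change\<close>).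

  Lower bound. If a rule stops by time \<open>k + N\<close> with non-negligible probability under \<open>law k m\<close>,
  then, \<open>Z\<close> being about \<open>q m N\<close> at that time, it does so under the no-change law with probability
  at least about \<open>exp (- q m N)\<close>. There is no change by that time with probability of order
  \<open>exp (- d N)\<close>, so the false alarm probability is at least of order \<open>exp (- (q m + d) N)\<close>. For this to
  be at most \<open>\<alpha>\<close>, \<open>N\<close> cannot be below \<open>L / (q m + d)\<close> by a fixed factor
  (\<open>stopped_early_bound\<close>, \<open>stop_after_horizon\<close>, \<open>ADD_lower_bound\<close>).

  Upper bound. By Bayes, the posterior no-change probability at time \<open>k + N - 1\<close> is at most a constant
  times \<open>exp (- Z - d N)\<close> (\<open>post_le_if_large_Z\<close>). Once \<open>N\<close> exceeds the last time \<open>Q\<close> at which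
  \<open>Z / N\<close> is off \<open>q m\<close> by more than \<open>\<epsilon>\<close>, this is at most \<open>\<alpha>\<close> as soon as \<open>N\<close> exceeds \<open>L / (q m + d - \<epsilon>)\<close>
  plus a constant. Hence the delay of the posterior rule is at most that number plus \<open>Q\<close>, and
  summability of the expectations of \<open>Q\<close> makes the second contribution a constant
  (\<open>T_RP_upper_bound\<close>, \<open>ADD_T_RP_upper_bound\<close>).

  The change point \<open>0\<close> needs care: the summability hypothesis is about \<open>k \<ge> 1\<close> only. For change
  point \<open>0\<close> the posterior is bounded through the statistic of the hypothetical change point \<open>1\<close> instead, at the price
  of one time unit. A sensor that has been reached under change point \<open>1\<close> has also been reached
  under change point \<open>0\<close>, so the observations entering this statistic have the same law under both. For this
  to be true the statistic may use no other sensors, which is why the whole proof works with the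
  log-likelihood ratio of the affected sensors only.
\<close>

section \<open>The laws given change point and source\<close>

locale deterministic_event_model = event_model +
  assumes rho1_one: "\<rho>1 = 1"
begin

definition cell :: "nat \<Rightarrow> nat \<Rightarrow> 'a set" where
  "cell k m = {\<omega> \<in> space P. t \<omega> = k \<and> Src \<omega> = src m}"

definition weight :: "nat \<Rightarrow> real" where
  "weight k = \<rho> * (1 - \<rho>) ^ k / real M"

definition law :: "nat \<Rightarrow> nat \<Rightarrow> 'a measure" where
  "law k m = uniform_measure P (cell k m)"

text \<open>
  The radius at time \<open>i\<close> under change point \<open>k\<close> when the growth is deterministic.
\<close>

definition radius :: "nat \<Rightarrow> nat \<Rightarrow> nat" where
  "radius k i = (if i < k then 0 else min (i - k + 1) (max_radius S M src))"

lemma weight_pos: "0 < weight k"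
  using rho M_pos by (simp add: weight_def)

lemma ennreal_weight_neq_0 [simp]: "ennreal (weight k) \<noteq> 0"
  using weight_pos[of k] by simp

lemma cell_sets [measurable]: "cell k m \<in> sets P"
proof -
  note Src_measurable[measurable] t_measurable[measurable]
  show ?thesis unfolding cell_def by measurable
qed

lemma prob_cell:
  assumes "m < M"
  shows "prob (cell k m) = weight k"
proof -
  let ?A = "Src -` {src m} \<inter> space P" and ?B = "t -` {k} \<inter> space P"
  have "?A \<in> sets (vimage_algebra (space P) Src borel)"
    by (rule in_vimage_algebra) auto
  moreover have "?B \<in> sets (vimage_algebra (space P) t (count_space UNIV))"
    by (rule in_vimage_algebra) auto
  ultimately have "prob (?A \<inter> ?B) = prob ?A * prob ?B"
    using indep_setD[OF Src_t_indep] by blast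
  moreover have "?A \<inter> ?B = cell k m" by (auto simp: cell_def)
  moreover have "?A = {\<omega> \<in> space P. Src \<omega> = src m}" "?B = {\<omega> \<in> space P. t \<omega> = k}" by auto
  ultimately show ?thesis
    using Src_uniform[OF assms] t_geometric[of k] by (simp add: weight_def)
qed

lemma emeasure_cell: "m < M \<Longrightarrow> emeasure P (cell k m) = ennreal (weight k)"
  by (simp add: emeasure_eq_measure prob_cell)

text \<open>
  Boundedness of \<open>S\<close> makes the \<open>LEAST\<close> in the definition of the maximal radius range over a nonempty
  set.
\<close>

lemma max_radius_covers:
  assumes "m < M" "s \<in> S"
  shows "norm (s - src m) < real (max_radius S M src)"
proof -
  obtain B where B: "\<And>x. x \<in> S \<Longrightarrow> norm x \<le> B"
    using bounded_S by (auto simp: bounded_iff)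
  obtain N :: nat where N: "2 * B < real N" using reals_Archimedean2 by blast
  have "\<forall>m<M. \<forall>s\<in>S. norm (s - src m) < real N"
  proof (intro allI impI ballI)
    fix m s assume "m < M" "s \<in> S"
    then have "norm (s - src m) \<le> norm s + norm (src m)" by (simp add: norm_triangle_ineq4)
    also have "\<dots> \<le> B + B"
      using \<open>m < M\<close> \<open>s \<in> S\<close> src_S by (intro add_mono B) auto
    finally show "norm (s - src m) < real N" using N by simp
  qed
  then have "\<forall>m<M. \<forall>s\<in>S. norm (s - src m) < real (max_radius S M src)"
    unfolding max_radius_def by (rule LeastI)
  with assms show ?thesis by blast
qed

lemma max_radius_pos: "1 \<le> max_radius S M src"
proof -
  have "src 0 \<in> S" using src_S M_pos by auto
  from max_radius_covers[OF _ this, of 0] M_pos show ?thesis by simp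
qed

text \<open>
  The likelihoods ignore the cap on the radius. This is harmless because at the cap the
  event already covers every sensor.
\<close>

lemma in_radius_iff_eta:
  assumes "m < M" "1 \<le> i" "a \<in> A i"
  shows "norm (a - src m) < real (radius k i) \<longleftrightarrow> a \<in> eta A src i k m"
proof (cases "i < k")
  case True
  then have "real i - real k + 1 \<le> 0" by linarith
  then have "a \<notin> eta A src i k m"
    unfolding eta_def using norm_ge_zero[of "a - src m"] by (auto simp del: norm_ge_zero)
  then show ?thesis using True by (simp add: radius_def)
next
  case False
  then have "real (i - k + 1) = real i - real k + 1" by simp
  moreover have "a \<in> S" using sensors[OF assms(2)] assms(3) by auto
  then have "norm (a - src m) < real (max_radius S M src)"
    using max_radius_covers assms(1) by blast
  ultimately show ?thesis
    using False assms(3) by (auto simp: radius_def eta_def min_def)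
qed

lemma history_sets [measurable]: "history P Src t R x k n r \<in> sets P"
proof -
  note Src_measurable[measurable] t_measurable[measurable] R_measurable[measurable]
  show ?thesis unfolding history_def by measurable
qed

text \<open>
  For \<open>\<rho>1 = 1\<close> the next radius is, conditionally on the history, certain.
\<close>

lemma history_radius_Suc:
  assumes "m < M" "k \<le> n" and pos: "prob (history P Src t R (src m) k n (radius k)) > 0"
  shows "prob (history P Src t R (src m) k (Suc n) (radius k))
    = prob (history P Src t R (src m) k n (radius k))"
proof -
  let ?H = "\<lambda>n. history P Src t R (src m) k n (radius k)"
  have "\<P>(\<omega> in P. R (Suc n) \<omega> = radius k (Suc n) \<bar> \<omega> \<in> ?H n) = 1"
  proof (cases "radius k n < max_radius S M src")
    case True
    then have "radius k (Suc n) = Suc (radius k n)"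
      using assms(2) by (auto simp: radius_def min_def split: if_splits)
    then show ?thesis using R_grow[OF assms(1,2) pos True] rho1_one by simp
  next
    case False
    then have e: "radius k n = max_radius S M src" by (auto simp: radius_def)
    moreover have "radius k (Suc n) = radius k n"
      using False assms(2) by (auto simp: radius_def min_def split: if_splits)
    ultimately show ?thesis using R_stay[OF assms(1,2) pos e] by simp
  qed
  moreover have "{\<omega> \<in> space P. R (Suc n) \<omega> = radius k (Suc n) \<and> \<omega> \<in> ?H n} = ?H (Suc n)"
    by (auto simp: history_def le_Suc_eq)
  moreover have "{\<omega> \<in> space P. \<omega> \<in> ?H n} = ?H n" by (auto simp: history_def)
  ultimately show ?thesis using pos by (simp add: cond_prob_def)
qed

lemma prob_history_radius:
  assumes "m < M"
  shows "prob (history P Src t R (src m) k n (radius k)) = weight k"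
proof (induction n)
  case 0
  have "history P Src t R (src m) k 0 (radius k) = cell k m"
    using R_before R_start max_radius_pos
    by (force simp: history_def cell_def radius_def min_def)
  then show ?case using prob_cell[OF assms] by simp
next
  case (Suc n)
  show ?case
  proof (cases "k \<le> n")
    case True
    then show ?thesis using history_radius_Suc[OF assms True] Suc weight_pos by simp
  next
    case False
    have "R i \<omega> = radius k i" if "\<omega> \<in> space P" "t \<omega> = k" "i \<le> Suc n" for i \<omega>
      using that False R_before[of \<omega> i] R_start[of \<omega>] max_radius_pos
      by (cases "i < k") (auto simp: radius_def min_def dest!: antisym_conv1)
    then have "history P Src t R (src m) k (Suc n) (radius k) = cell k m"
      by (auto simp: history_def cell_def)
    then show ?thesis using prob_cell[OF assms] by simp
  qed
qed

lemma AE_history_eq_cell: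
  assumes "m < M"
  shows "AE \<omega> in P. \<omega> \<in> history P Src t R (src m) k n (radius k) \<longleftrightarrow> \<omega> \<in> cell k m"
proof -
  let ?H = "history P Src t R (src m) k n (radius k)"
  have sub: "?H \<subseteq> cell k m" by (auto simp: history_def cell_def)
  have "prob (cell k m - ?H) = 0"
    using finite_measure_Diff[OF cell_sets history_sets sub] prob_history_radius[OF assms] prob_cell[OF assms]
    by simp
  then have "cell k m - ?H \<in> null_sets P"
    by (intro null_setsI) (simp_all add: emeasure_eq_measure)
  then have "AE \<omega> in P. \<omega> \<notin> cell k m - ?H" by (rule AE_not_in)
  then show ?thesis using sub by auto
qed

text \<open>
  The model describes the observations conditionally on a finite piece of the radius history. As the radii are
  almost surely those of \<open>radius\<close>, this is the same as conditioning on change point and source alone.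
\<close>

lemma uniform_measure_history:
  assumes "m < M"
  shows "uniform_measure P (history P Src t R (src m) k n (radius k)) = law k m"
proof (rule measure_eqI)
  let ?H = "history P Src t R (src m) k n (radius k)"
  fix B assume "B \<in> sets (uniform_measure P ?H)"
  then have B[measurable]: "B \<in> sets P" by simp
  have "emeasure P (?H \<inter> B) = emeasure P (cell k m \<inter> B)" "emeasure P ?H = emeasure P (cell k m)"
    using AE_history_eq_cell[OF assms, of k n] by (auto intro!: emeasure_eq_AE)
  then show "emeasure (uniform_measure P ?H) B = emeasure (law k m) B"
    by (simp add: law_def)
qed (simp add: law_def)

lemma prob_space_law: "m < M \<Longrightarrow> prob_space (law k m)"
  unfolding law_def
  by (rule prob_space_uniform_measure) (simp_all add: emeasure_cell)

lemma sets_law [measurable_cong, simp]: "sets (law k m) = sets P"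
  and space_law [simp]: "space (law k m) = space P"
  by (simp_all add: law_def)

lemma emeasure_law:
  assumes "m < M" "B \<in> sets P"
  shows "emeasure P (cell k m \<inter> B) = ennreal (weight k) * emeasure (law k m) B"
  using assms weight_pos[of k]
  by (simp add: law_def emeasure_cell ennreal_mult_divide_eq mult.commute[of "ennreal _"]
      ennreal_divide_times)

lemma nn_integral_law:
  assumes "m < M" and [measurable]: "f \<in> borel_measurable P"
  shows "(\<integral>\<^sup>+\<omega>. f \<omega> * indicator (cell k m) \<omega> \<partial>P) = ennreal (weight k) * (\<integral>\<^sup>+\<omega>. f \<omega> \<partial>law k m)"
  using assms weight_pos[of k]
  by (simp add: law_def nn_integral_uniform_measure emeasure_cell mult.commute[of "ennreal _"]
      ennreal_divide_times ennreal_mult_divide_eq)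

lemma AE_law_iff:
  assumes "m < M"
  shows "(AE \<omega> in law k m. pr \<omega>) \<longleftrightarrow> (AE \<omega> in P. \<omega> \<in> cell k m \<longrightarrow> pr \<omega>)"
  unfolding law_def
  by (rule AE_uniform_measure) (use assms weight_pos[of k] in \<open>simp_all add: emeasure_cell\<close>)

definition obs_density :: "nat \<Rightarrow> nat \<Rightarrow> nat \<Rightarrow> point \<Rightarrow> real \<Rightarrow> real" where
  "obs_density k m i a x = (if a \<in> eta A src i k m then f1 a (src m) x else f0 x)"

lemma is_pdf_obs_density: "m < M \<Longrightarrow> 1 \<le> i \<Longrightarrow> a \<in> A i \<Longrightarrow> is_pdf (obs_density k m i a)"
  using pdf0 pdf1[of i a m]
  by (cases "a \<in> eta A src i k m") (simp_all add: obs_density_def[abs_def])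

lemma indep_law:
  assumes "m < M"
  shows "prob_space.indep_vars (law k m) (\<lambda>_. borel) (\<lambda>(i, a). X i a) (SIGMA i:{1..}. A i)"
proof -
  interpret L: prob_space "law k m" by (rule prob_space_law[OF assms])
  have *: "L.indep_vars (\<lambda>_. borel) (\<lambda>(i, a). X i a) (SIGMA i:{1..n}. A i)" for n
    using X_indep[OF assms, of k n "radius k"] prob_history_radius[OF assms, of k n] weight_pos[of k]
    by (simp add: uniform_measure_history[OF assms])
  show ?thesis
    unfolding L.indep_vars_def
  proof (intro conjI ballI)
    fix p assume "p \<in> (SIGMA i:{1..}. A i)"
    then show "(case p of (i, a) \<Rightarrow> X i a) \<in> measurable (law k m) borel"
      using X_measurable by auto
  next
    let ?F = "\<lambda>i. sigma_sets (space (law k m))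
      {(case i of (i, a) \<Rightarrow> X i a) -` A \<inter> space (law k m) |A. A \<in> sets borel}"
    show "L.indep_sets ?F (SIGMA i:{1..}. A i)"
    proof (subst L.indep_sets_finite_index_sets, intro allI impI)
      fix J assume J: "J \<subseteq> (SIGMA i:{1..}. A i)" "J \<noteq> {}" "finite J"
      let ?n = "Max (fst ` J)"
      have "J \<subseteq> (SIGMA i:{1..?n}. A i)" proof
        fix p assume p: "p \<in> J"
        then have "fst p \<le> ?n" using J by (intro Max_ge) auto
        then show "p \<in> (SIGMA i:{1..?n}. A i)" using J p by (cases p) auto
      qed
      then have "L.indep_vars (\<lambda>_. borel) (\<lambda>(i, a). X i a) J"
        using * L.indep_vars_subset by blast
      then show "L.indep_sets ?F J" unfolding L.indep_vars_def by blast
    qed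
  qed
qed

lemma density_law:
  assumes "m < M" "1 \<le> i" "a \<in> A i"
  shows "distr (law k m) borel (X i a) = density lborel (obs_density k m i a)"
proof -
  have "distributed (law k m) lborel (X i a) (\<lambda>x. ennreal (obs_density k m i a x))"
    using X_density[OF assms(1), of k i "radius k" i a] prob_history_radius[OF assms(1), of k i]
      weight_pos[of k] assms
    by (simp add: uniform_measure_history[OF assms(1)] in_radius_iff_eta[OF assms] obs_density_def)
  then show ?thesis
    by (simp add: distributed_distr_eq_density[symmetric] cong: distr_cong)
qed

text \<open>
  Infinite \<open>J\<close> serve to compare the laws of whole observation sequences.
\<close>

definition obs :: "(nat \<times> point) set \<Rightarrow> 'a \<Rightarrow> nat \<times> point \<Rightarrow> real" where
  "obs J \<omega> = (\<lambda>p\<in>J. X (fst p) (snd p) \<omega>)"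

lemma obs_measurable:
  assumes "J \<subseteq> (SIGMA i:{1..}. A i)"
  shows "obs J \<in> measurable P (PiM J (\<lambda>_. borel))"
  unfolding obs_def
  by (rule measurable_restrict) (use assms X_measurable in force)

lemma distr_obs:
  assumes "m < M" and J: "J \<subseteq> (SIGMA i:{1..}. A i)"
  shows "distr (law k m) (PiM J (\<lambda>_. borel)) (obs J)
    = PiM J (\<lambda>p. density lborel (\<lambda>x. ennreal (obs_density k m (fst p) (snd p) x)))"
proof -
  interpret L: prob_space "law k m" by (rule prob_space_law[OF assms(1)])
  have d: "distr (law k m) borel (case p of (i, a) \<Rightarrow> X i a) = density lborel (\<lambda>x. ennreal (obs_density k m (fst p) (snd p) x))"
    if "p \<in> J" for p
    using that J density_law[OF assms(1), of "fst p" "snd p" k] by (auto simp: case_prod_beta)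
  have o: "obs J = (\<lambda>\<omega>. \<lambda>p\<in>J. (case p of (i, a) \<Rightarrow> X i a) \<omega>)"
    by (auto simp: obs_def fun_eq_iff case_prod_beta)
  (* The vector of no observations is constant; the joint-law criterion for independence covers the rest. *)
  show ?thesis
  proof (cases "J = {}")
    case True
    have "obs {} = (\<lambda>_. (\<lambda>_. undefined))" by (auto simp: obs_def fun_eq_iff)
    then show ?thesis using True L.emeasure_space_1
      by (auto intro!: measure_eqI simp: emeasure_distr PiM_empty sets_PiM_empty
          subset_singleton_iff emeasure_count_space_finite space_PiM_empty)
  next
    case False
    have "L.indep_vars (\<lambda>_. borel) (\<lambda>(i, a). X i a) J"
      using L.indep_vars_subset[OF indep_law[OF assms(1)] J] .
    then have "distr (law k m) (PiM J (\<lambda>_. borel)) (obs J)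
      = PiM J (\<lambda>p. distr (law k m) borel (case p of (i, a) \<Rightarrow> X i a))"
      unfolding o using J X_measurable
      by (subst L.indep_vars_iff_distr_eq_PiM'[symmetric]) (use False in \<open>auto\<close>)
    also have "\<dots> = PiM J (\<lambda>p. density lborel (\<lambda>x. ennreal (obs_density k m (fst p) (snd p) x)))"
      by (rule PiM_cong) (use d in auto)
    finally show ?thesis .
  qed
qed

end

section \<open>Likelihood ratios and densities\<close>

lemma PiM_density_lborel:
  fixes f :: "'i \<Rightarrow> real \<Rightarrow> ennreal"
  assumes I: "finite I"
    and f: "\<And>i. i \<in> I \<Longrightarrow> f i \<in> borel_measurable borel"
    and prob: "\<And>i. i \<in> I \<Longrightarrow> prob_space (density lborel (f i))"
  shows "PiM I (\<lambda>i. density lborel (f i)) = density (PiM I (\<lambda>_. lborel)) (\<lambda>x. \<Prod>i\<in>I. f i (x i))"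
proof -
  (* The product construction asks for a sigma-finite measure at every index, also outside I. *)
  define N where "N i = (if i \<in> I then density lborel (f i) else lborel)" for i
  have "sigma_finite_measure (N i)" for i
  proof (cases "i \<in> I")
    case True
    then interpret prob_space "N i" using prob by (simp add: N_def)
    show ?thesis by unfold_locales
  qed (simp add: N_def lborel.sigma_finite_measure_axioms)
  then interpret N: product_sigma_finite N by (simp add: product_sigma_finite_def)
  interpret L: product_sigma_finite "\<lambda>_::'i. lborel :: real measure"
    by (simp add: product_sigma_finite_def lborel.sigma_finite_measure_axioms)
  note f[measurable]
  have "density (PiM I (\<lambda>_. lborel)) (\<lambda>x. \<Prod>i\<in>I. f i (x i)) = PiM I N"
  proof (rule N.PiM_eqI[OF I])
    show "sets (density (PiM I (\<lambda>_. lborel)) (\<lambda>x. \<Prod>i\<in>I. f i (x i))) = sets (PiM I N)"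
      by (simp, rule sets_PiM_cong) (auto simp: N_def)
  next
    fix B assume "\<And>i. i \<in> I \<Longrightarrow> B i \<in> sets (N i)"
    then have B[measurable]: "\<And>i. i \<in> I \<Longrightarrow> B i \<in> sets borel" by (auto simp: N_def)
    have PB: "Pi\<^sub>E I B \<in> sets (PiM I (\<lambda>_. lborel))"
      using I B by (intro sets_PiM_I_finite) auto
    have M: "(\<lambda>x. \<Prod>i\<in>I. f i (x i)) \<in> borel_measurable (PiM I (\<lambda>_. lborel))"
      by measurable
    have "emeasure (density (PiM I (\<lambda>_. lborel)) (\<lambda>x. \<Prod>i\<in>I. f i (x i))) (Pi\<^sub>E I B)
      = (\<integral>\<^sup>+x. (\<Prod>i\<in>I. f i (x i)) * indicator (Pi\<^sub>E I B) x \<partial>PiM I (\<lambda>_. lborel))"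
      using PB M by (rule emeasure_density[rotated])
    also have "\<dots> = (\<integral>\<^sup>+x. (\<Prod>i\<in>I. f i (x i) * indicator (B i) (x i)) \<partial>PiM I (\<lambda>_. lborel))"
    proof (rule nn_integral_cong)
      fix x assume "x \<in> space (PiM I (\<lambda>_. lborel :: real measure))"
      then have "x \<in> extensional I" by (auto simp: space_PiM PiE_def)
      then show "(\<Prod>i\<in>I. f i (x i)) * indicator (Pi\<^sub>E I B) x
        = (\<Prod>i\<in>I. f i (x i) * indicator (B i) (x i))"
        using I by (auto simp: prod.distrib PiE_iff indicator_def prod_zero_iff)
    qed
    also have "\<dots> = (\<Prod>i\<in>I. \<integral>\<^sup>+x. f i x * indicator (B i) x \<partial>lborel)"
      using I by (intro L.product_nn_integral_prod) auto
    also have "\<dots> = (\<Prod>i\<in>I. emeasure (N i) (B i))"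
      using f B by (intro prod.cong refl) (simp add: N_def emeasure_density)
    finally show "emeasure (density (PiM I (\<lambda>_. lborel)) (\<lambda>x. \<Prod>i\<in>I. f i (x i))) (Pi\<^sub>E I B)
      = (\<Prod>i\<in>I. emeasure (N i) (B i))" .
  qed
  also have "PiM I N = PiM I (\<lambda>i. density lborel (f i))"
    by (rule PiM_cong) (auto simp: N_def)
  finally show ?thesis by simp
qed

text \<open>
  Positivity of the denominators excludes \<open>\<infinity>\<close> as a summand, so a sum of log-ratios with a vanishing numerator is
  \<open>-\<infinity>\<close> and cannot reach \<open>c\<close>.
\<close>

lemma exp_le_prod_ratio:
  assumes "finite I" and "\<And>i. i \<in> I \<Longrightarrow> 0 \<le> x i" and "\<And>i. i \<in> I \<Longrightarrow> 0 < y i"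
    and "ereal c \<le> (\<Sum>i\<in>I. log_ratio (x i) (y i))"
  shows "exp c * (\<Prod>i\<in>I. y i) \<le> (\<Prod>i\<in>I. x i)"
proof (cases "\<exists>i\<in>I. x i = 0")
  case True
  then obtain j where j: "j \<in> I" "x j = 0" by blast
  have ninf: "log_ratio (x i) (y i) \<noteq> \<infinity>" if "i \<in> I" for i
    using assms(3)[OF that] by (auto simp: log_ratio_def)
  have "log_ratio (x j) (y j) = -\<infinity>"
    using j assms(3)[of j] by (auto simp: log_ratio_def)
  moreover have "(\<Sum>i\<in>I - {j}. log_ratio (x i) (y i)) \<noteq> \<infinity>"
    using ninf assms(1) by (subst sum_Pinfty) auto
  ultimately have "(\<Sum>i\<in>I. log_ratio (x i) (y i)) = -\<infinity>"
    using assms(1) j by (cases "\<Sum>i\<in>I - {j}. log_ratio (x i) (y i)") (simp_all add: sum.remove[of I j])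
  with assms(4) show ?thesis by simp
next
  case False
  then have pos: "0 < x i" if "i \<in> I" for i
    using assms(2)[OF that] that by (auto simp: less_le)
  have "(\<Sum>i\<in>I. log_ratio (x i) (y i)) = (\<Sum>i\<in>I. ereal (ln (x i / y i)))"
    using pos assms(3) by (intro sum.cong refl) (force simp: log_ratio_def)
  then have "c \<le> (\<Sum>i\<in>I. ln (x i / y i))" using assms(4) by simp
  then have "exp c \<le> (\<Prod>i\<in>I. x i / y i)"
    using pos assms(3) by (subst (asm) exp_le_cancel_iff[symmetric]) (simp add: exp_sum assms(1))
  then show ?thesis
    using assms(1,3) prod_pos[of I y] by (simp add: prod_dividef pos_le_divide_eq)
qed

lemma log_ratio_swap: "0 < x \<Longrightarrow> log_ratio y x = - log_ratio x y"
  by (auto simp: log_ratio_def ln_div)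

text \<open>
  The mirror image of \<open>exp_le_prod_ratio\<close>. Negating the extended real sum is sound because
  positive numerators exclude \<open>-\<infinity>\<close> as a summand.
\<close>

lemma prod_ratio_le_exp:
  assumes "finite I" and "\<And>i. i \<in> I \<Longrightarrow> 0 < x i" and "\<And>i. i \<in> I \<Longrightarrow> 0 \<le> y i"
    and "(\<Sum>i\<in>I. log_ratio (x i) (y i)) \<le> ereal c"
  shows "(\<Prod>i\<in>I. x i) \<le> exp c * (\<Prod>i\<in>I. y i)"
proof -
  have "log_ratio (x i) (y i) \<noteq> -\<infinity>" if "i \<in> I" for i
    using assms(2)[OF that] by (auto simp: log_ratio_def)
  then have "(\<Sum>i\<in>I. log_ratio (x i) (y i)) \<noteq> -\<infinity> \<and>
      (\<Sum>i\<in>I. - log_ratio (x i) (y i)) = - (\<Sum>i\<in>I. log_ratio (x i) (y i))"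
    using assms(1)
  proof (induction I rule: infinite_finite_induct)
    case (insert i J)
    then have "log_ratio (x i) (y i) \<noteq> -\<infinity>" "(\<Sum>i\<in>J. log_ratio (x i) (y i)) \<noteq> -\<infinity>"
      "(\<Sum>i\<in>J. - log_ratio (x i) (y i)) = - (\<Sum>i\<in>J. log_ratio (x i) (y i))" by simp_all
    moreover have "u + v \<noteq> -\<infinity> \<and> - u + - v = - (u + v)" if "u \<noteq> -\<infinity>" "v \<noteq> -\<infinity>" for u v :: ereal
      using that by (cases u; cases v) auto
    ultimately show ?case using insert.hyps by simp
  qed auto
  moreover have "(\<Sum>i\<in>I. log_ratio (y i) (x i)) = (\<Sum>i\<in>I. - log_ratio (x i) (y i))"
    using assms(2) by (intro sum.cong log_ratio_swap) auto
  ultimately have "ereal (- c) \<le> (\<Sum>i\<in>I. log_ratio (y i) (x i))"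
    using assms(4) by (simp add: ereal_uminus_le_reorder flip: uminus_ereal.simps)
  from exp_le_prod_ratio[OF assms(1) _ _ this] have "exp (- c) * (\<Prod>i\<in>I. x i) \<le> (\<Prod>i\<in>I. y i)"
    using assms(2,3) by auto
  then have "exp c * (exp (- c) * (\<Prod>i\<in>I. x i)) \<le> exp c * (\<Prod>i\<in>I. y i)"
    by (intro mult_left_mono) auto
  then show ?thesis by (simp add: mult.assoc[symmetric] flip: exp_add)
qed

lemma log_ratio_cancel: "0 < c \<Longrightarrow> log_ratio (x * c) (y * c) = log_ratio x y"
  by (auto simp: log_ratio_def)

lemma log_ratio_self [simp]: "log_ratio x x = 0"
  by (auto simp: log_ratio_def)

lemma borel_measurable_log_ratio [measurable (raw)]:
  assumes [measurable]: "u \<in> borel_measurable N" "v \<in> borel_measurable N"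
  shows "(\<lambda>x. log_ratio (u x) (v x)) \<in> borel_measurable N"
  unfolding log_ratio_def by measurable

lemma eta_empty: "i < k \<Longrightarrow> eta A src i k m = {}"
proof -
  assume "i < k"
  then have "real i - real k + 1 \<le> 0" by linarith
  then show ?thesis unfolding eta_def by (auto simp: not_less intro: order_trans)
qed

lemma eta_eta [simp]: "eta (\<lambda>i. eta A src i k m) src n k m = eta A src n k m"
  by (auto simp: eta_def)

text \<open>
  No sensor is affected before the change point, so earlier times contribute \<open>log_ratio x x = 0\<close>.
  Starting every sum at time \<open>1\<close> lines \<open>Z\<close> up with the product densities below.
\<close>

lemma Z_eq_sum_from_1:
  "Z A src f0 f1 X k m n \<omega> =
    (\<Sum>i = 1..n. log_ratio (lik1 A src f0 f1 k m i (\<lambda>a. X i a \<omega>)) (lik0 A f0 i (\<lambda>a. X i a \<omega>)))"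
  unfolding Z_def
  by (rule sum.mono_neutral_left) (auto simp: eta_empty lik1_def lik0_def)

context deterministic_event_model
begin

text \<open>
  Restricting the sensor sets to the affected sensors turns \<open>Z\<close> into a function of their
  observations alone. Wherever the unaffected sensors have positive density under \<open>f0\<close>, their factors
  cancel and nothing changes. If the event really started earlier, such a sensor may show a value with
  \<open>f0 x = 0\<close>; then \<open>Z\<close> loses the whole factor of that time to the convention \<open>log (0 / 0) = 0\<close>,
  while the restricted sum keeps it.
\<close>

definition affected :: "nat \<Rightarrow> nat \<Rightarrow> nat \<Rightarrow> point set" where
  "affected k m i = eta A src i k m"

abbreviation Z_affected :: "(nat \<Rightarrow> point \<Rightarrow> 'b \<Rightarrow> real) \<Rightarrow> nat \<Rightarrow> nat \<Rightarrow> nat \<Rightarrow> 'b \<Rightarrow> ereal" where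
  "Z_affected Y k m \<equiv> Z (affected k m) src f0 f1 Y k m"

lemma affected_subset: "affected k m i \<subseteq> A i"
  by (auto simp: affected_def eta_def)

lemma finite_A: "1 \<le> i \<Longrightarrow> finite (A i)"
  using sensors by blast

lemma f_measurable [measurable]: "f0 \<in> borel_measurable borel"
  using pdf0 by (simp add: is_pdf_def)

lemma f0_nonneg: "0 \<le> f0 x"
  using pdf0 by (simp add: is_pdf_def)

lemma f1_measurable: "m < M \<Longrightarrow> 1 \<le> i \<Longrightarrow> a \<in> A i \<Longrightarrow> f1 a (src m) \<in> borel_measurable borel"
  and f1_nonneg: "m < M \<Longrightarrow> 1 \<le> i \<Longrightarrow> a \<in> A i \<Longrightarrow> 0 \<le> f1 a (src m) x"
  using pdf1[of i a m] by (simp_all add: is_pdf_def)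

lemma borel_measurable_Z:
  assumes "m < M" and B: "\<And>i. B i \<subseteq> A i"
    and Y: "\<And>i a. 1 \<le> i \<Longrightarrow> i \<le> n \<Longrightarrow> a \<in> B i \<Longrightarrow> Y i a \<in> borel_measurable N"
  shows "Z B src f0 f1 Y k m n \<in> borel_measurable N"
proof -
  have [measurable]: "(\<lambda>x. f1 a (src m) (Y i a x)) \<in> borel_measurable N"
    "(\<lambda>x. f0 (Y i a x)) \<in> borel_measurable N" if "1 \<le> i" "i \<le> n" "a \<in> B i" for i a
    using f1_measurable[OF assms(1) that(1), of a] B that
    by (auto intro: measurable_compose[OF Y[OF that]])
  have [measurable]: "(\<lambda>x. lik1 B src f0 f1 k m i (\<lambda>a. Y i a x)) \<in> borel_measurable N"
    "(\<lambda>x. lik0 B f0 i (\<lambda>a. Y i a x)) \<in> borel_measurable N" if "i \<in> {1..n}" for i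
    unfolding lik1_def lik0_def using that
    by (auto intro!: borel_measurable_times borel_measurable_prod simp: eta_def)
  show ?thesis unfolding Z_eq_sum_from_1[abs_def] by measurable
qed

text \<open>
  The three products split the likelihood at a time \<open>i\<close>: with and without change it is
  \<open>affected_lik1 * unaffected_lik\<close> and \<open>affected_lik0 * unaffected_lik\<close>, respectively.
\<close>

definition affected_lik1 :: "nat \<Rightarrow> nat \<Rightarrow> nat \<Rightarrow> (point \<Rightarrow> real) \<Rightarrow> real" where
  "affected_lik1 k m i x = (\<Prod>a\<in>affected k m i. f1 a (src m) (x a))"

definition affected_lik0 :: "nat \<Rightarrow> nat \<Rightarrow> nat \<Rightarrow> (point \<Rightarrow> real) \<Rightarrow> real" where
  "affected_lik0 k m i x = (\<Prod>a\<in>affected k m i. f0 (x a))"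

definition unaffected_lik :: "nat \<Rightarrow> nat \<Rightarrow> nat \<Rightarrow> (point \<Rightarrow> real) \<Rightarrow> real" where
  "unaffected_lik k m i x = (\<Prod>a\<in>A i - affected k m i. f0 (x a))"

lemma Z_affected_eq: "Z_affected Y k m n \<omega> = (\<Sum>i = 1..n. log_ratio (affected_lik1 k m i (\<lambda>a. Y i a \<omega>)) (affected_lik0 k m i (\<lambda>a. Y i a \<omega>)))"
  by (simp add: Z_eq_sum_from_1 lik1_def lik0_def affected_lik1_def affected_lik0_def affected_def[abs_def])

lemma Z_eq: "Z A src f0 f1 Y k m n \<omega> = (\<Sum>i = 1..n. log_ratio
    (affected_lik1 k m i (\<lambda>a. Y i a \<omega>) * unaffected_lik k m i (\<lambda>a. Y i a \<omega>))
    (affected_lik0 k m i (\<lambda>a. Y i a \<omega>) * unaffected_lik k m i (\<lambda>a. Y i a \<omega>)))"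
  unfolding Z_eq_sum_from_1
proof (intro sum.cong refl arg_cong2[where f=log_ratio])
  fix i assume "i \<in> {1..n}"
  then have "finite (A i)" using finite_A by simp
  then show "lik0 A f0 i (\<lambda>a. Y i a \<omega>) = affected_lik0 k m i (\<lambda>a. Y i a \<omega>) * unaffected_lik k m i (\<lambda>a. Y i a \<omega>)"
    using prod.subset_diff[OF affected_subset] by (simp add: lik0_def affected_lik0_def unaffected_lik_def mult.commute)
qed (simp add: lik1_def affected_lik1_def unaffected_lik_def affected_def)

lemma affected_lik1_nonneg: "m < M \<Longrightarrow> 1 \<le> i \<Longrightarrow> 0 \<le> affected_lik1 k m i x"
  unfolding affected_lik1_def using affected_subset f1_nonneg by (intro prod_nonneg) blast

lemma affected_lik0_nonneg: "0 \<le> affected_lik0 k m i x"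
  unfolding affected_lik0_def by (intro prod_nonneg) (simp add: f0_nonneg)

lemma unaffected_lik_nonneg: "0 \<le> unaffected_lik k m i x"
  unfolding unaffected_lik_def by (intro prod_nonneg) (simp add: f0_nonneg)

section \<open>Change of measure on the observations up to a time\<close>

definition window :: "nat \<Rightarrow> (nat \<times> point) set" where
  "window n = (SIGMA i:{1..n}. A i)"

lemma finite_window: "finite (window n)"
  unfolding window_def using finite_A by (intro finite_SigmaI) auto

lemma window_subset: "window n \<subseteq> (SIGMA i:{1..}. A i)"
  by (auto simp: window_def)

definition joint_density :: "nat \<Rightarrow> nat \<Rightarrow> nat \<Rightarrow> (nat \<times> point \<Rightarrow> real) \<Rightarrow> real" where
  "joint_density k m n x = (\<Prod>i = 1..n. affected_lik1 k m i (\<lambda>a. x (i, a)) * unaffected_lik k m i (\<lambda>a. x (i, a)))"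

lemma joint_density_eq_prod_obs_density:
  assumes "m < M"
  shows "ennreal (joint_density k m n x) = (\<Prod>p\<in>window n. ennreal (obs_density k m (fst p) (snd p) (x p)))"
proof -
  have "joint_density k m n x = (\<Prod>i = 1..n. \<Prod>a\<in>A i. obs_density k m i a (x (i, a)))"
    unfolding joint_density_def
  proof (intro prod.cong refl)
    fix i assume "i \<in> {1..n}"
    then have "finite (A i)" using finite_A by simp
    then have "(\<Prod>a\<in>A i. obs_density k m i a (x (i, a)))
      = (\<Prod>a\<in>A i - affected k m i. obs_density k m i a (x (i, a))) * (\<Prod>a\<in>affected k m i. obs_density k m i a (x (i, a)))"
      by (intro prod.subset_diff affected_subset)
    then show "affected_lik1 k m i (\<lambda>a. x (i, a)) * unaffected_lik k m i (\<lambda>a. x (i, a)) = (\<Prod>a\<in>A i. obs_density k m i a (x (i, a)))"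
      by (simp add: affected_lik1_def unaffected_lik_def obs_density_def affected_def mult.commute)
  qed
  also have "\<dots> = (\<Prod>p\<in>window n. obs_density k m (fst p) (snd p) (x p))"
    unfolding window_def using finite_A by (subst prod.Sigma) (auto simp: case_prod_beta)
  finally show ?thesis
    using is_pdf_obs_density[OF assms] by (subst prod_ennreal) (auto simp: window_def is_pdf_def)
qed

text \<open>
  The right-hand side mentions \<open>k\<close> and \<open>m\<close> only through a splitting of the sensors, which may be
  chosen to match the law that is to be compared with.
\<close>

lemma joint_density_no_change:
  assumes "n < j"
  shows "joint_density j m' n x = (\<Prod>i = 1..n. affected_lik0 k m i (\<lambda>a. x (i, a)) * unaffected_lik k m i (\<lambda>a. x (i, a)))"
  unfolding joint_density_def
proof (intro prod.cong refl)
  fix i assume i: "i \<in> {1..n}"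
  then have "finite (A i)" using finite_A by simp
  then have "(\<Prod>a\<in>A i. f0 (x (i, a)))
    = (\<Prod>a\<in>A i - affected k m i. f0 (x (i, a))) * (\<Prod>a\<in>affected k m i. f0 (x (i, a)))"
    by (intro prod.subset_diff affected_subset)
  moreover have "affected j m' i = {}" using i assms by (simp add: affected_def eta_empty)
  ultimately show "affected_lik1 j m' i (\<lambda>a. x (i, a)) * unaffected_lik j m' i (\<lambda>a. x (i, a))
    = affected_lik0 k m i (\<lambda>a. x (i, a)) * unaffected_lik k m i (\<lambda>a. x (i, a))"
    by (simp add: affected_lik1_def unaffected_lik_def affected_lik0_def mult.commute)
qed

lemma emeasure_law_window:
  assumes "m < M" and B: "B \<in> sets (PiM (window n) (\<lambda>_. borel))"
  shows "emeasure (law k m) (obs (window n) -` B \<inter> space P)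
    = (\<integral>\<^sup>+x. ennreal (joint_density k m n x) * indicator B x \<partial>PiM (window n) (\<lambda>_. lborel))"
proof -
  let ?L = "PiM (window n) (\<lambda>_. lborel :: real measure)"
  let ?f = "\<lambda>p x. ennreal (obs_density k m (fst p) (snd p) x)"
  have pdf: "is_pdf (obs_density k m (fst p) (snd p))" if "p \<in> window n" for p
    using that is_pdf_obs_density[OF assms(1)] by (auto simp: window_def)
  have f: "?f p \<in> borel_measurable borel" if "p \<in> window n" for p
    using pdf[OF that] by (auto simp: is_pdf_def)
  have BL: "B \<in> sets ?L"
    using B sets_PiM_cong[OF refl, of "window n" "\<lambda>_. borel" "\<lambda>_. lborel :: real measure"] by simp
  have m: "(\<lambda>x. \<Prod>p\<in>window n. ?f p (x p)) \<in> borel_measurable ?L"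
  proof (rule borel_measurable_prod_ennreal)
    fix p assume "p \<in> window n"
    then show "(\<lambda>x. ?f p (x p)) \<in> borel_measurable ?L"
      using f[of p] by (intro measurable_compose[OF measurable_component_singleton]) auto
  qed
  have "emeasure (law k m) (obs (window n) -` B \<inter> space P)
    = emeasure (distr (law k m) (PiM (window n) (\<lambda>_. borel)) (obs (window n))) B"
    using B obs_measurable[OF window_subset]
    by (subst emeasure_distr) (auto simp: measurable_cong_sets[OF sets_law refl])
  also have "distr (law k m) (PiM (window n) (\<lambda>_. borel)) (obs (window n)) = PiM (window n) (\<lambda>p. density lborel (?f p))"
    by (rule distr_obs[OF assms(1) window_subset])
  also have "\<dots> = density ?L (\<lambda>x. \<Prod>p\<in>window n. ?f p (x p))"
    using finite_window f pdf by (intro PiM_density_lborel) (auto simp: is_pdf_def)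
  also have "emeasure \<dots> B = (\<integral>\<^sup>+x. (\<Prod>p\<in>window n. ?f p (x p)) * indicator B x \<partial>?L)"
    by (rule emeasure_density[OF m BL])
  finally show ?thesis by (simp add: joint_density_eq_prod_obs_density[OF assms(1)])
qed

lemma space_info [simp]: "space (info P A X n) = space P"
  by (auto simp: info_def space_measure_of_conv)

lemma info_gen: "{X i a -` B \<inter> space P | i a B. 1 \<le> i \<and> enat i \<le> n \<and> a \<in> A i \<and> B \<in> sets borel} \<subseteq> Pow (space P)"
  by auto

lemma sets_info_subset: "sets (info P A X n) \<subseteq> sets P"
  unfolding info_def using X_measurable
  by (subst sets_measure_of[OF info_gen]) (auto intro!: sets.sigma_sets_subset)

lemma info_mono: "j \<le> n \<Longrightarrow> sets (info P A X j) \<subseteq> sets (info P A X n)"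
  unfolding info_def
  by (subst (1 2) sets_measure_of[OF info_gen]) (intro sigma_sets_mono'; force intro: order_trans)

lemma X_info:
  assumes "1 \<le> i" "enat i \<le> n" "a \<in> A i"
  shows "X i a \<in> borel_measurable (info P A X n)"
  using assms by (intro measurableI) (auto simp: info_def space_measure_of_conv sets_measure_of[OF info_gen])

text \<open>
  An event known at time \<open>n\<close> is a condition on the vector of observations up to time \<open>n\<close>, to which
  joint densities apply.
\<close>

lemma info_vimage_obs:
  assumes "G \<in> sets (info P A X (enat n))"
  obtains B where "B \<in> sets (PiM (window n) (\<lambda>_. borel))" "G = obs (window n) -` B \<inter> space P"
proof -
  let ?V = "vimage_algebra (space P) (obs (window n)) (PiM (window n) (\<lambda>_. borel))"
  have o: "obs (window n) \<in> space P \<rightarrow> space (PiM (window n) (\<lambda>_. borel))"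
    using measurable_space[OF obs_measurable[OF window_subset]] by auto
  have "sets (info P A X (enat n)) \<subseteq> sets ?V"
    unfolding info_def sets_measure_of[OF info_gen]
  proof (rule sets.sigma_sets_subset[of _ ?V, unfolded space_vimage_algebra], safe)
    fix i a and B :: "real set" assume *: "1 \<le> i" "enat i \<le> enat n" "a \<in> A i" "B \<in> sets borel"
    then have w: "(i, a) \<in> window n" by (auto simp: window_def)
    have "X i a -` B \<inter> space P = obs (window n) -` ((\<lambda>x. x (i, a)) -` B \<inter> space (PiM (window n) (\<lambda>_. borel))) \<inter> space P"
      using w o by (auto simp: obs_def)
    moreover have "(\<lambda>x. x (i, a)) -` B \<inter> space (PiM (window n) (\<lambda>_. borel)) \<in> sets (PiM (window n) (\<lambda>_. borel :: real measure))"
      using w * by (intro measurable_sets[OF measurable_component_singleton]) auto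
    then have "obs (window n) -` ((\<lambda>x. x (i, a)) -` B \<inter> space (PiM (window n) (\<lambda>_. borel))) \<inter> space P \<in> sets ?V"
      by (rule in_vimage_algebra)
    ultimately show "X i a -` B \<inter> space P \<in> sets ?V" by simp
  qed
  then have "G \<in> sets ?V" using assms by blast
  then show ?thesis using that sets_vimage_algebra2[OF o] by auto
qed

lemma Z_affected_info: "m < M \<Longrightarrow> Z_affected X k m n \<in> borel_measurable (info P A X (enat n))"
  using affected_subset[of k m] by (intro borel_measurable_Z X_info) auto

text \<open>
  Substituting coordinates for the observations makes the statistic a function on the product space, where
  the densities live.
\<close>

lemma Z_affected_obs:
  assumes "\<And>i. 1 \<le> i \<Longrightarrow> i \<le> n \<Longrightarrow> Pair i ` affected k m i \<subseteq> J"
  shows "Z_affected (\<lambda>i a x. x (i, a)) k m n (obs J \<omega>) = Z_affected X k m n \<omega>"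
  unfolding Z_affected_eq using assms
  by (intro sum.cong arg_cong2[where f=log_ratio]) (auto simp: affected_lik1_def affected_lik0_def obs_def image_subset_iff intro!: prod.cong)

lemma Z_affected_coordinates:
  assumes "m < M" "\<And>i. 1 \<le> i \<Longrightarrow> i \<le> n \<Longrightarrow> Pair i ` affected k m i \<subseteq> J"
  shows "Z_affected (\<lambda>i a x. x (i, a)) k m n \<in> borel_measurable (PiM J (\<lambda>_. borel))"
  using assms affected_subset[of k m]
  by (intro borel_measurable_Z measurable_component_singleton) auto

lemma window_affected: "1 \<le> i \<Longrightarrow> i \<le> n \<Longrightarrow> Pair i ` affected k m i \<subseteq> window n"
  using affected_subset by (fastforce simp: window_def)

text \<open>
  An inequality between the joint densities integrates to one between the laws. It is only needed where the
  statistic lies in \<open>V\<close>: the event \<open>G\<close> is the preimage of a set of observation vectors, which can be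
  shrunk to those with statistic in \<open>V\<close> without changing the preimage.
\<close>

lemma change_of_measure:
  assumes "m < M" "m1 < M" "m2 < M" and G: "G \<in> sets (info P A X (enat n))" and r: "0 \<le> r"
    and Z: "\<And>\<omega>. \<omega> \<in> G \<Longrightarrow> Z_affected X k m n \<omega> \<in> V" and V: "V \<in> sets borel"
    and dom: "\<And>x. Z_affected (\<lambda>i a x. x (i, a)) k m n x \<in> V \<Longrightarrow> joint_density k1 m1 n x \<le> r * joint_density k2 m2 n x"
  shows "measure (law k1 m1) G \<le> r * measure (law k2 m2) G"
proof -
  let ?zz = "Z_affected (\<lambda>i a x. x (i, a)) k m n"
  let ?L = "PiM (window n) (\<lambda>_. lborel :: real measure)"
  interpret L1: prob_space "law k1 m1" by (rule prob_space_law[OF assms(2)])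
  interpret L2: prob_space "law k2 m2" by (rule prob_space_law[OF assms(3)])
  obtain B where B: "B \<in> sets (PiM (window n) (\<lambda>_. borel))" "G = obs (window n) -` B \<inter> space P"
    by (rule info_vimage_obs[OF G])
  (* B may contain vectors that are never observed and violate the condition on the statistic. *)
  define C where "C = B \<inter> (?zz -` V \<inter> space (PiM (window n) (\<lambda>_. borel)))"
  have C: "C \<in> sets (PiM (window n) (\<lambda>_. borel))"
    unfolding C_def using B(1) V
    by (intro sets.Int measurable_sets[OF Z_affected_coordinates[OF assms(1)]] window_affected) auto
  have o: "obs (window n) \<omega> \<in> space (PiM (window n) (\<lambda>_. borel))" if "\<omega> \<in> space P" for \<omega>
    using measurable_space[OF obs_measurable[OF window_subset] that] .
  have "?zz (obs (window n) \<omega>) = Z_affected X k m n \<omega>" for \<omega>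
    by (rule Z_affected_obs) (rule window_affected)
  then have GC: "G = obs (window n) -` C \<inter> space P"
    using B(2) Z o by (auto simp: C_def)
  have CL: "C \<in> sets ?L"
    using C sets_PiM_cong[OF refl, of "window n" "\<lambda>_. borel" "\<lambda>_. lborel :: real measure"] by simp
  have sets: "sets ?L = sets (PiM (window n) (\<lambda>_. borel))"
    by (rule sets_PiM_cong) auto
  have pdf: "is_pdf (obs_density k2 m2 (fst p) (snd p))" if "p \<in> window n" for p
    using that is_pdf_obs_density[OF assms(3)] by (auto simp: window_def)
  have jm: "(\<lambda>x. ennreal (joint_density k2 m2 n x)) \<in> borel_measurable ?L"
    unfolding joint_density_eq_prod_obs_density[OF assms(3)]
  proof (rule borel_measurable_prod_ennreal)
    fix p assume p: "p \<in> window n"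
    have "(\<lambda>x. ennreal (obs_density k2 m2 (fst p) (snd p) x)) \<in> borel_measurable lborel"
      using pdf[OF p] by (auto simp: is_pdf_def)
    then show "(\<lambda>x. ennreal (obs_density k2 m2 (fst p) (snd p) (x p))) \<in> borel_measurable ?L"
      using p by (intro measurable_compose[OF measurable_component_singleton])
  qed
  have "emeasure (law k1 m1) G = (\<integral>\<^sup>+x. ennreal (joint_density k1 m1 n x) * indicator C x \<partial>?L)"
    unfolding GC by (rule emeasure_law_window[OF assms(2) C])
  also have "\<dots> \<le> (\<integral>\<^sup>+x. ennreal r * (ennreal (joint_density k2 m2 n x) * indicator C x) \<partial>?L)"
  proof (rule nn_integral_mono)
    fix x
    show "ennreal (joint_density k1 m1 n x) * indicator C x \<le> ennreal r * (ennreal (joint_density k2 m2 n x) * indicator C x)"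
      using dom[of x] r by (auto simp: C_def indicator_def ennreal_mult'[symmetric] intro!: ennreal_leI)
  qed
  also have "\<dots> = ennreal r * (\<integral>\<^sup>+x. ennreal (joint_density k2 m2 n x) * indicator C x \<partial>?L)"
    using CL jm by (intro nn_integral_cmult) auto
  also have "\<dots> = ennreal r * emeasure (law k2 m2) G"
    unfolding GC by (subst emeasure_law_window[OF assms(3) C]) simp
  finally have "ennreal (measure (law k1 m1) G) \<le> ennreal (r * measure (law k2 m2) G)"
    using r by (simp add: L1.emeasure_eq_measure L2.emeasure_eq_measure ennreal_mult)
  then show ?thesis using r by (simp add: ennreal_le_iff measure_nonneg)
qed

text \<open>
  Change points beyond \<open>n\<close>, and the source, cannot be told apart by time \<open>n\<close>.
\<close>

lemma law_no_change_unique: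
  assumes "m1 < M" "m2 < M" "n < j1" "n < j2" and G: "G \<in> sets (info P A X (enat n))"
  shows "measure (law j1 m1) G = measure (law j2 m2) G"
proof -
  have eq: "joint_density j1 m1 n x = joint_density j2 m2 n x" for x
    using joint_density_no_change[OF assms(3), of m1 x 0 0] joint_density_no_change[OF assms(4), of m2 x 0 0] by simp
  have "measure (law j1 m1) G \<le> 1 * measure (law j2 m2) G"
    by (rule change_of_measure[OF assms(1,1,2) G, where V=UNIV and k=0]) (simp_all add: eq)
  moreover have "measure (law j2 m2) G \<le> 1 * measure (law j1 m1) G"
    by (rule change_of_measure[OF assms(1,2,1) G, where V=UNIV and k=0]) (simp_all add: eq)
  ultimately show ?thesis by simp
qed

text \<open>
  On the observation vectors where the no-change density is positive, \<open>exp c\<close> times it is at most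
  the density under \<open>law k m\<close> by \<open>exp_le_prod_ratio\<close>; elsewhere there is nothing to compare.
\<close>

lemma no_change_le_change:
  assumes "m < M" "m' < M" "n < j" and G: "G \<in> sets (info P A X (enat n))"
    and Z: "\<And>\<omega>. \<omega> \<in> G \<Longrightarrow> ereal c \<le> Z_affected X k m n \<omega>"
  shows "measure (law j m') G \<le> exp (- c) * measure (law k m) G"
proof (rule change_of_measure[where V="{ereal c..}", OF assms(1,2,1) G])
  fix x assume z: "Z_affected (\<lambda>i a x. x (i, a)) k m n x \<in> {ereal c..}"
  let ?n = "\<lambda>i. affected_lik1 k m i (\<lambda>a. x (i, a))" and ?d = "\<lambda>i. affected_lik0 k m i (\<lambda>a. x (i, a))"
    and ?r = "\<lambda>i. unaffected_lik k m i (\<lambda>a. x (i, a))"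
  have e: "joint_density j m' n x = (\<Prod>i = 1..n. ?d i) * (\<Prod>i = 1..n. ?r i)"
    "joint_density k m n x = (\<Prod>i = 1..n. ?n i) * (\<Prod>i = 1..n. ?r i)"
    unfolding joint_density_no_change[OF assms(3), where k=k and m=m] by (simp_all add: joint_density_def prod.distrib)
  have nn: "0 \<le> (\<Prod>i = 1..n. ?n i)" "0 \<le> (\<Prod>i = 1..n. ?r i)"
    using affected_lik1_nonneg[OF assms(1)] unaffected_lik_nonneg by (auto intro!: prod_nonneg)
  have "exp c * (\<Prod>i = 1..n. ?d i) \<le> (\<Prod>i = 1..n. ?n i)"
  proof (cases "\<exists>i\<in>{1..n}. ?d i = 0")
    case True
    then have "(\<Prod>i = 1..n. ?d i) = 0" by (intro prod_zero) auto
    then show ?thesis using nn by (simp only: mult_zero_right)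
  next
    case False
    then have "0 < ?d i" if "i \<in> {1..n}" for i
      using that affected_lik0_nonneg[of k m i "\<lambda>a. x (i, a)"] by (auto simp: less_le)
    then show ?thesis
      using z affected_lik1_nonneg[OF assms(1)] by (intro exp_le_prod_ratio) (auto simp: Z_affected_eq)
  qed
  then have "exp (- c) * (exp c * (\<Prod>i = 1..n. ?d i)) \<le> exp (- c) * (\<Prod>i = 1..n. ?n i)"
    by (intro mult_left_mono) auto
  then have "(\<Prod>i = 1..n. ?d i) \<le> exp (- c) * (\<Prod>i = 1..n. ?n i)"
    by (simp add: mult.assoc[symmetric] flip: exp_add)
  then show "joint_density j m' n x \<le> exp (- c) * joint_density k m n x"
    unfolding e using nn(2) by (simp only: mult.assoc[symmetric] mult_right_mono)
qed (use Z in auto)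

text \<open>
  As for \<open>no_change_le_change\<close>, with the roles of the two densities exchanged.
\<close>

lemma change_le_no_change:
  assumes "m < M" "m' < M" "n < j" and G: "G \<in> sets (info P A X (enat n))"
    and Z: "\<And>\<omega>. \<omega> \<in> G \<Longrightarrow> Z_affected X k m n \<omega> \<le> ereal c"
  shows "measure (law k m) G \<le> exp c * measure (law j m') G"
proof (rule change_of_measure[where V="{..ereal c}", OF assms(1,1,2) G])
  fix x assume z: "Z_affected (\<lambda>i a x. x (i, a)) k m n x \<in> {..ereal c}"
  let ?n = "\<lambda>i. affected_lik1 k m i (\<lambda>a. x (i, a))" and ?d = "\<lambda>i. affected_lik0 k m i (\<lambda>a. x (i, a))"
    and ?r = "\<lambda>i. unaffected_lik k m i (\<lambda>a. x (i, a))"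
  have e: "joint_density j m' n x = (\<Prod>i = 1..n. ?d i) * (\<Prod>i = 1..n. ?r i)"
    "joint_density k m n x = (\<Prod>i = 1..n. ?n i) * (\<Prod>i = 1..n. ?r i)"
    unfolding joint_density_no_change[OF assms(3), where k=k and m=m] by (simp_all add: joint_density_def prod.distrib)
  have nn: "0 \<le> (\<Prod>i = 1..n. ?d i)" "0 \<le> (\<Prod>i = 1..n. ?r i)"
    using affected_lik0_nonneg unaffected_lik_nonneg by (auto intro!: prod_nonneg)
  have "(\<Prod>i = 1..n. ?n i) \<le> exp c * (\<Prod>i = 1..n. ?d i)"
  proof (cases "\<exists>i\<in>{1..n}. ?n i = 0")
    case True
    then have "(\<Prod>i = 1..n. ?n i) = 0" by (intro prod_zero) auto
    then show ?thesis using nn(1) by (simp only: zero_le_mult_iff exp_ge_zero simp_thms)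
  next
    case False
    then have "0 < ?n i" if "i \<in> {1..n}" for i
      using that affected_lik1_nonneg[OF assms(1), of i k "\<lambda>a. x (i, a)"] by (auto simp: less_le)
    then show ?thesis
      using z affected_lik0_nonneg by (intro prod_ratio_le_exp) (auto simp: Z_affected_eq)
  qed
  then show "joint_density k m n x \<le> exp c * joint_density j m' n x"
    unfolding e using nn(2) by (simp only: mult.assoc[symmetric] mult_right_mono)
qed (use Z in auto)

end

lemma vimage_ray_Int:
  "f -` {c..} \<inter> U = {x \<in> U. c \<le> f x}" "f -` {..c} \<inter> U = {x \<in> U. f x \<le> c}" "f -` {c<..} \<inter> U = {x \<in> U. c < f x}"
  for c :: "'b :: order"
  by auto

context deterministic_event_model
begin

section \<open>False alarms and the posterior no-change probability\<close>

lemma AE_obs_density_pos: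
  assumes "m < M"
  shows "AE \<omega> in law k m. \<forall>i\<in>{1..}. \<forall>a\<in>A i. 0 < obs_density k m i a (X i a \<omega>)"
proof (rule AE_ball_countable[THEN iffD2, OF countableI_type], rule ballI,
    rule AE_ball_countable[THEN iffD2, OF countable_finite], use finite_A in force, rule ballI)
  fix i a assume i: "i \<in> {1::nat..}" and a: "a \<in> A i"
  have [measurable]: "obs_density k m i a \<in> borel_measurable borel"
    using is_pdf_obs_density[OF assms, of i a] i a by (auto simp: is_pdf_def)
  have X: "X i a \<in> measurable (law k m) borel"
    using X_measurable i a by auto
  have "AE x in distr (law k m) borel (X i a). 0 < obs_density k m i a x"
    using i a by (subst density_law[OF assms]) (auto simp: AE_density)
  then show "AE \<omega> in law k m. 0 < obs_density k m i a (X i a \<omega>)"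
    by (rule AE_distrD[OF X])
qed

text \<open>
  Under its own law an unaffected sensor has density \<open>f0\<close> and so almost surely shows a value at which
  \<open>f0\<close> is positive; its factor then cancels from numerator and denominator.
\<close>

lemma AE_Z_eq_Z_affected:
  assumes "m < M"
  shows "AE \<omega> in P. \<omega> \<in> cell k m \<longrightarrow> (\<forall>n. Z A src f0 f1 X k m n \<omega> = Z_affected X k m n \<omega>)"
  unfolding AE_law_iff[OF assms, symmetric]
  using AE_obs_density_pos[OF assms, of k]
proof eventually_elim
  case (elim \<omega>)
  show ?case
  proof
    fix n
    have "0 < unaffected_lik k m i (\<lambda>a. X i a \<omega>)" if "i \<in> {1..n}" for i
      unfolding unaffected_lik_def
    proof (intro prod_pos)
      fix a assume "a \<in> A i - affected k m i"
      then show "0 < f0 (X i a \<omega>)"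
        using elim that by (auto simp: obs_density_def affected_def split: if_splits)
    qed
    then show "Z A src f0 f1 X k m n \<omega> = Z_affected X k m n \<omega>"
      unfolding Z_eq Z_affected_eq by (intro sum.cong refl log_ratio_cancel)
  qed
qed

lemma Z_affected_measurable [measurable]: "m < M \<Longrightarrow> Z_affected X k m n \<in> borel_measurable P"
  using affected_subset[of k m] X_measurable by (intro borel_measurable_Z) auto

lemma measure_law_eq:
  assumes "m < M" "B \<in> sets P"
  shows "weight k * measure (law k m) B = prob (cell k m \<inter> B)"
proof -
  interpret L: prob_space "law k m" by (rule prob_space_law[OF assms(1)])
  show ?thesis
    using emeasure_law[OF assms, of k] weight_pos[of k]
    by (simp add: emeasure_eq_measure L.emeasure_eq_measure measure_nonneg flip: ennreal_mult)
qed

lemma stopping_time_sets: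
  "stopping_time (info P A X) T \<Longrightarrow> {\<omega> \<in> space P. T \<omega> \<le> n} \<in> sets (info P A X n)"
  using stopping_timeD[of "info P A X" T n] by (simp add: pred_def)

text \<open>
  Stopping by time \<open>n\<close> while \<open>Z\<close> is at most \<open>c\<close> is at most \<open>exp c\<close> times as likely under \<open>law k m\<close> as
  without change. Without change it is a false alarm, already if the change point is \<open>n + 1\<close>, and the false
  alarm constraint bounds this case alone by \<open>\<alpha> / weight (Suc n)\<close>.
\<close>

lemma stopped_early_bound:
  assumes T: "T \<in> Delta P A t X \<alpha>" and "m < M"
  shows "measure (law k m) {\<omega> \<in> space P. T \<omega> \<le> enat n}
    \<le> measure (law k m) {\<omega> \<in> space P. ereal c < Z_affected X k m n \<omega>} + exp c * (\<alpha> / weight (Suc n))"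
proof -
  interpret L: prob_space "law k m" by (rule prob_space_law[OF assms(2)])
  interpret L': prob_space "law (Suc n) m" by (rule prob_space_law[OF assms(2)])
  let ?S = "{\<omega> \<in> space P. T \<omega> \<le> enat n}"
  define G where "G = ?S \<inter> {\<omega> \<in> space P. Z_affected X k m n \<omega> \<le> ereal c}"
  have st: "stopping_time (info P A X) T" and pfa: "PFA P t T \<le> \<alpha>"
    using T by (auto simp: Delta_def)
  have S: "?S \<in> sets (info P A X (enat n))" by (rule stopping_time_sets[OF st])
  then have SP[measurable]: "?S \<in> sets P" using sets_info_subset by blast
  have "(Z_affected X k m n -` {..ereal c}) \<inter> space (info P A X (enat n)) \<in> sets (info P A X (enat n))"
    by (rule measurable_sets[OF Z_affected_info[OF assms(2)]]) simp
  then have G: "G \<in> sets (info P A X (enat n))"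
    unfolding G_def using S by (intro sets.Int) (simp_all add: vimage_ray_Int)
  have GP: "G \<in> sets P" using G sets_info_subset by blast
  have "measure (law k m) ?S
    \<le> measure (law k m) (G \<union> {\<omega> \<in> space P. ereal c < Z_affected X k m n \<omega>})"
  proof (rule L.finite_measure_mono)
    have "{\<omega> \<in> space P. ereal c < Z_affected X k m n \<omega>} \<in> sets P"
      using Z_affected_measurable[OF assms(2), measurable] by measurable
    then show "G \<union> {\<omega> \<in> space P. ereal c < Z_affected X k m n \<omega>} \<in> sets (law k m)" using GP by simp
  qed (auto simp: G_def)
  also have "\<dots> \<le> measure (law k m) G + measure (law k m) {\<omega> \<in> space P. ereal c < Z_affected X k m n \<omega>}"
  proof (rule measure_Un_le)
    show "{\<omega> \<in> space P. ereal c < Z_affected X k m n \<omega>} \<in> sets (law k m)"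
      using Z_affected_measurable[OF assms(2), measurable] by simp
  qed (use GP in simp)
  also have "measure (law k m) G \<le> exp c * measure (law (Suc n) m) G"
    by (rule change_le_no_change[OF assms(2,2) _ G]) (auto simp: G_def)
  also have "measure (law (Suc n) m) G \<le> \<alpha> / weight (Suc n)"
  proof -
    have "weight (Suc n) * measure (law (Suc n) m) G = prob (cell (Suc n) m \<inter> G)"
      by (rule measure_law_eq[OF assms(2) GP])
    also have "\<dots> \<le> PFA P t T"
      unfolding PFA_def
    proof (rule finite_measure_mono)
      show "cell (Suc n) m \<inter> G \<subseteq> {\<omega> \<in> space P. T \<omega> < enat (t \<omega>)}"
        by (auto simp: cell_def G_def order.strict_trans1)
      have [measurable]: "T \<in> borel_measurable P"
        by (rule measurable_stopping_time[OF st sets_info_subset space_info])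
      have [measurable]: "(\<lambda>\<omega>. enat (t \<omega>)) \<in> borel_measurable P"
        by (rule measurable_compose[OF t_measurable]) simp
      show "{\<omega> \<in> space P. T \<omega> < enat (t \<omega>)} \<in> sets P" by measurable
    qed
    finally show ?thesis using pfa weight_pos[of "Suc n"] by (simp add: pos_le_divide_eq mult.commute)
  qed
  finally show ?thesis by (simp add: mult_left_mono algebra_simps)
qed

lemma AE_cells: "AE \<omega> in P. \<exists>m<M. Src \<omega> = src m"
proof -
  note Src_measurable[measurable]
  let ?E = "\<lambda>m. {\<omega> \<in> space P. Src \<omega> = src m}"
  have "prob (\<Union>m<M. ?E m) = (\<Sum>m<M. prob (?E m))"
    using src_inj by (intro finite_measure_finite_Union) (auto simp: disjoint_family_on_def inj_on_def)
  also have "\<dots> = 1" using Src_uniform M_pos by simp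
  finally have "AE \<omega> in P. \<omega> \<in> (\<Union>m<M. ?E m)"
    by (subst (asm) prob_eq_1) auto
  then show ?thesis by eventually_elim auto
qed

text \<open>
  Almost every outcome lies in exactly one cell, the sources being distinct.
\<close>

lemma nn_integral_cells:
  assumes [measurable]: "f \<in> borel_measurable P"
  shows "(\<integral>\<^sup>+\<omega>. f \<omega> \<partial>P) = (\<Sum>m<M. \<Sum>k. \<integral>\<^sup>+\<omega>. f \<omega> * indicator (cell k m) \<omega> \<partial>P)"
proof -
  have "(\<integral>\<^sup>+\<omega>. f \<omega> \<partial>P) = (\<integral>\<^sup>+\<omega>. (\<Sum>m<M. \<Sum>k. f \<omega> * indicator (cell k m) \<omega>) \<partial>P)"
  proof (rule nn_integral_cong_AE)
    show "AE \<omega> in P. f \<omega> = (\<Sum>m<M. \<Sum>k. f \<omega> * indicator (cell k m) \<omega>)"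
      using AE_cells AE_space
    proof eventually_elim
      case (elim \<omega>)
      then obtain m where m: "m < M" "Src \<omega> = src m" by blast
      have i: "indicator (cell k m') \<omega> = (if m' = m \<and> k = t \<omega> then 1 else 0 :: ennreal)" if "m' < M" for k m'
        using that m elim inj_onD[OF src_inj, of m m'] by (auto simp: cell_def indicator_def)
      have "(\<Sum>k. f \<omega> * indicator (cell k m') \<omega>) = (if m' = m then f \<omega> else 0)" if "m' < M" for m'
        using suminf_finite[of "{t \<omega>}" "\<lambda>k. f \<omega> * indicator (cell k m') \<omega>"] that by (simp add: i)
      then show ?case using m by (simp add: sum.delta)
    qed
  qed
  also have "\<dots> = (\<Sum>m<M. \<integral>\<^sup>+\<omega>. (\<Sum>k. f \<omega> * indicator (cell k m) \<omega>) \<partial>P)"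
    by (rule nn_integral_sum) measurable
  also have "\<dots> = (\<Sum>m<M. \<Sum>k. \<integral>\<^sup>+\<omega>. f \<omega> * indicator (cell k m) \<omega> \<partial>P)"
    by (intro sum.cong refl nn_integral_suminf) measurable
  finally show ?thesis .
qed

text \<open>
  All laws with change point beyond \<open>n\<close> give \<open>G\<close> the same probability, so summing over these change
  points multiplies it by the geometric tail \<open>(1 - \<rho>) ^ Suc n\<close>.
\<close>

lemma prob_no_change_le:
  assumes G: "G \<in> sets (info P A X (enat n))" and m: "m < M"
  shows "prob ({\<omega> \<in> space P. R n \<omega> = 0} \<inter> G) \<le> (1 - \<rho>) ^ Suc n * measure (law (Suc n) m) G"
proof -
  define c where "c = measure (law (Suc n) m) G"
  let ?E = "{\<omega> \<in> space P. R n \<omega> = 0} \<inter> G"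
  have GP: "G \<in> sets P" using G sets_info_subset by blast
  note R_measurable[measurable] GP[measurable]
  have E[measurable]: "?E \<in> sets P" by measurable
  have c0: "0 \<le> c" by (simp add: c_def)
  have le: "(\<integral>\<^sup>+\<omega>. indicator ?E \<omega> * indicator (cell k m') \<omega> \<partial>P) \<le> ennreal (if n < k then weight k * c else 0)"
    if "m' < M" for k m'
  proof (cases "n < k")
    case True
    interpret L: prob_space "law k m'" by (rule prob_space_law[OF that])
    have "(\<integral>\<^sup>+\<omega>. indicator ?E \<omega> * indicator (cell k m') \<omega> \<partial>P) = ennreal (weight k) * emeasure (law k m') ?E"
      by (subst nn_integral_law[OF that]) auto
    also have "\<dots> \<le> ennreal (weight k) * emeasure (law k m') G"
      using GP by (intro mult_left_mono emeasure_mono) auto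
    also have "\<dots> = ennreal (weight k * c)"
      using law_no_change_unique[OF that m True _ G, of "Suc n"] weight_pos[of k]
      by (simp add: L.emeasure_eq_measure c_def ennreal_mult)
    finally show ?thesis using True by simp
  next
    case False
    have "AE \<omega> in P. indicator ?E \<omega> * indicator (cell k m') \<omega> = (0 :: ennreal)"
      using AE_history_eq_cell[OF that, of k n]
    proof eventually_elim
      case (elim \<omega>)
      then have "\<omega> \<in> cell k m' \<Longrightarrow> R n \<omega> = radius k n" by (auto simp: history_def)
      moreover have "radius k n \<noteq> 0" using False max_radius_pos by (simp add: radius_def)
      ultimately show ?case by (auto simp: indicator_def)
    qed
    then show ?thesis by (simp add: nn_integral_0_iff_AE False)
  qed
  have "(\<lambda>k. (weight (k + Suc n) * c)) sums (((1 - \<rho>) ^ Suc n * c / M) * \<rho> * (1 / (1 - (1 - \<rho>))))"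
    using sums_mult[OF geometric_sums[of "1 - \<rho>"], of "(1 - \<rho>) ^ Suc n * c / M * \<rho>"] rho
    by (simp add: weight_def power_add mult_ac)
  then have "(\<lambda>k. if n < k then weight k * c else 0) sums ((1 - \<rho>) ^ Suc n * c / M)"
    using rho by (subst sums_zero_iff_shift[of "Suc n", symmetric]) (auto simp: less_Suc_eq_le)
  then have sm: "(\<Sum>k. ennreal (if n < k then weight k * c else 0)) = ennreal ((1 - \<rho>) ^ Suc n * c / M)"
    using c0 weight_pos by (intro suminf_ennreal_eq) (auto simp: less_imp_le)
  have "emeasure P ?E = (\<integral>\<^sup>+\<omega>. indicator ?E \<omega> \<partial>P)" using E by simp
  also have "\<dots> = (\<Sum>m'<M. \<Sum>k. \<integral>\<^sup>+\<omega>. indicator ?E \<omega> * indicator (cell k m') \<omega> \<partial>P)"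
    by (rule nn_integral_cells) measurable
  also have "\<dots> \<le> (\<Sum>m'<M. \<Sum>k. ennreal (if n < k then weight k * c else 0))"
    using le by (intro sum_mono suminf_le) auto
  also have "\<dots> = ennreal ((1 - \<rho>) ^ Suc n * c)"
    unfolding sm using M_pos c0 rho
    by (simp add: ennreal_of_nat_eq_real_of_nat flip: ennreal_mult)
  finally show ?thesis
    using c0 rho by (simp add: emeasure_eq_measure c_def)
qed

lemma post_measurable: "post_no_change P A R X n \<in> borel_measurable (info P A X (enat n))"
  unfolding post_no_change_def by simp

text \<open>
  The defining property of the conditional expectation, tested on the event \<open>G\<close>.
\<close>

lemma integral_post:
  assumes G: "G \<in> sets (info P A X (enat n))"
  shows "prob ({\<omega> \<in> space P. R n \<omega> = 0} \<inter> G) = (\<integral>\<omega>. indicator G \<omega> * post_no_change P A R X n \<omega> \<partial>P)"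
    and "integrable P (\<lambda>\<omega>. indicator G \<omega> * post_no_change P A R X n \<omega>)"
proof -
  note R_measurable[measurable]
  interpret F: finite_measure_subalgebra P "info P A X (enat n)"
    by unfold_locales (auto simp: subalgebra_def sets_info_subset)
  let ?E = "{\<omega> \<in> space P. R n \<omega> = 0}"
  have GP[measurable]: "G \<in> sets P" using G sets_info_subset by blast
  have E[measurable]: "?E \<in> sets P" by measurable
  have int: "integrable P (indicator ?E :: 'a \<Rightarrow> real)" by (simp add: emeasure_eq_measure)
  have "prob (?E \<inter> G) = (\<integral>\<omega>. indicator (?E \<inter> G) \<omega> \<partial>P)" by (simp add: Int_absorb1)
  also have "\<dots> = (\<integral>\<omega>\<in>G. indicator ?E \<omega> \<partial>P)"
    unfolding set_lebesgue_integral_def by (intro Bochner_Integration.integral_cong) (auto simp: indicator_def)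
  also have "\<dots> = (\<integral>\<omega>\<in>G. post_no_change P A R X n \<omega> \<partial>P)"
    unfolding post_no_change_def by (rule F.real_cond_exp_intA[OF int G])
  finally show "prob (?E \<inter> G) = (\<integral>\<omega>. indicator G \<omega> * post_no_change P A R X n \<omega> \<partial>P)"
    by (simp add: set_lebesgue_integral_def)
  show "integrable P (\<lambda>\<omega>. indicator G \<omega> * post_no_change P A R X n \<omega>)"
    using integrable_mult_indicator[OF GP F.real_cond_exp_int(1)[OF int]] by (simp add: post_no_change_def)
qed

text \<open>
  Bayes' bound on the posterior, obtained without a formula for it. Let \<open>G\<close> be the event that the
  posterior exceeds \<open>\<alpha>\<close> although the statistic is at least \<open>c\<close>. Integrating the posterior over \<open>G\<close> gives
  more than \<open>\<alpha> prob G\<close>, but also the probability of \<open>G\<close> without change, which the change of measure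
  bounds by a smaller multiple of \<open>prob G\<close>. So \<open>G\<close> is null.
\<close>

lemma post_le_if_large_Z:
  assumes "m < M" and c: "(1 - \<rho>) ^ Suc n * exp (- c) < \<alpha> * weight k"
  shows "AE \<omega> in P. ereal c \<le> Z_affected X k m n \<omega> \<longrightarrow> post_no_change P A R X n \<omega> \<le> \<alpha>"
proof -
  define G where "G = {\<omega> \<in> space P. \<alpha> < post_no_change P A R X n \<omega>} \<inter> {\<omega> \<in> space P. ereal c \<le> Z_affected X k m n \<omega>}"
  have "(Z_affected X k m n -` {ereal c..}) \<inter> space (info P A X (enat n)) \<in> sets (info P A X (enat n))"
    by (rule measurable_sets[OF Z_affected_info[OF assms(1)]]) simp
  moreover have "(post_no_change P A R X n -` {\<alpha><..}) \<inter> space (info P A X (enat n)) \<in> sets (info P A X (enat n))"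
    by (rule measurable_sets[OF post_measurable]) simp
  ultimately have G: "G \<in> sets (info P A X (enat n))"
    unfolding G_def by (intro sets.Int) (simp_all add: vimage_ray_Int)
  have GP[measurable]: "G \<in> sets P" using G sets_info_subset by blast
  have "\<alpha> * prob G = (\<integral>\<omega>. indicator G \<omega> * \<alpha> \<partial>P)" by (simp add: Int_absorb2 sets.sets_into_space)
  also have "\<dots> \<le> (\<integral>\<omega>. indicator G \<omega> * post_no_change P A R X n \<omega> \<partial>P)"
  proof (rule integral_mono[OF _ integral_post(2)[OF G]])
    show "integrable P (\<lambda>\<omega>. indicator G \<omega> * \<alpha>)" by (simp add: emeasure_eq_measure)
    show "indicator G \<omega> * \<alpha> \<le> indicator G \<omega> * post_no_change P A R X n \<omega>" for \<omega>
      by (cases "\<omega> \<in> G") (auto simp: G_def)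
  qed
  also have "\<dots> = prob ({\<omega> \<in> space P. R n \<omega> = 0} \<inter> G)" by (rule integral_post(1)[OF G, symmetric])
  also have "\<dots> \<le> (1 - \<rho>) ^ Suc n * measure (law (Suc n) m) G" by (rule prob_no_change_le[OF G assms(1)])
  also have "\<dots> \<le> (1 - \<rho>) ^ Suc n * (exp (- c) * measure (law k m) G)"
    using rho by (intro mult_left_mono no_change_le_change[OF assms(1,1) _ G]) (auto simp: G_def)
  finally have "\<alpha> * prob G * weight k \<le> (1 - \<rho>) ^ Suc n * (exp (- c) * measure (law k m) G) * weight k"
    using weight_pos[of k] by (intro mult_right_mono) auto
  also have "\<dots> = (1 - \<rho>) ^ Suc n * exp (- c) * prob (cell k m \<inter> G)"
    using measure_law_eq[OF assms(1) GP, of k] by (simp add: mult_ac)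
  also have "\<dots> \<le> (1 - \<rho>) ^ Suc n * exp (- c) * prob G"
    using rho by (intro mult_left_mono finite_measure_mono) auto
  finally have "(\<alpha> * weight k - (1 - \<rho>) ^ Suc n * exp (- c)) * prob G \<le> 0" by (simp add: algebra_simps)
  then have "prob G = 0"
    using c measure_nonneg[of P G] by (simp add: mult_le_0_iff)
  then have "G \<in> null_sets P" by (intro null_setsI) (auto simp: emeasure_eq_measure)
  then have "AE \<omega> in P. \<omega> \<notin> G" by (rule AE_not_in)
  then show ?thesis using AE_space by eventually_elim (auto simp: G_def)
qed

text \<open>
  Infima in \<^typ>\<open>enat\<close> are attained, so at a finite stopping time the posterior really is at most \<open>\<alpha>\<close>.
\<close>

lemma T_RP_le_iff: "T_RP P A R X \<alpha> \<omega> \<le> enat n \<longleftrightarrow> (\<exists>j\<le>n. post_no_change P A R X j \<omega> \<le> \<alpha>)"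
proof -
  let ?S = "{enat n | n. post_no_change P A R X n \<omega> \<le> \<alpha>}"
  show ?thesis
  proof
    assume le: "T_RP P A R X \<alpha> \<omega> \<le> enat n"
    have "?S \<noteq> {}"
    proof
      assume "?S = {}"
      then have "T_RP P A R X \<alpha> \<omega> = \<infinity>" unfolding T_RP_def by (simp add: Inf_enat_def del: Collect_empty_eq)
      with le show False by simp
    qed
    then have "Inf ?S \<in> ?S" unfolding Inf_enat_def by (auto intro: LeastI)
    with le show "\<exists>j\<le>n. post_no_change P A R X j \<omega> \<le> \<alpha>" unfolding T_RP_def by auto
  next
    assume "\<exists>j\<le>n. post_no_change P A R X j \<omega> \<le> \<alpha>"
    then obtain j where j: "j \<le> n" "post_no_change P A R X j \<omega> \<le> \<alpha>" by blast
    then have "Inf ?S \<le> enat j" by (intro Inf_lower) auto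
    with j(1) show "T_RP P A R X \<alpha> \<omega> \<le> enat n" unfolding T_RP_def by (auto elim: order_trans)
  qed
qed

lemma stopping_time_T_RP: "stopping_time (info P A X) (T_RP P A R X \<alpha>)"
proof (rule stopping_timeI)
  fix e :: enat
  show "Measurable.pred (info P A X e) (\<lambda>\<omega>. T_RP P A R X \<alpha> \<omega> \<le> e)"
  proof (cases e)
    case (enat n)
    have "{\<omega> \<in> space P. T_RP P A R X \<alpha> \<omega> \<le> enat n} = (\<Union>j\<in>{..n}. post_no_change P A R X j -` {..\<alpha>} \<inter> space (info P A X (enat n)))"
      by (auto simp: T_RP_le_iff)
    also have "\<dots> \<in> sets (info P A X (enat n))"
    proof (intro sets.finite_UN)
      fix j assume "j \<in> {..n}"
      then have "post_no_change P A R X j \<in> borel_measurable (info P A X (enat n))"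
        using post_measurable[of j] info_mono[of "enat j" "enat n"] by (auto simp: measurable_def)
      then show "post_no_change P A R X j -` {..\<alpha>} \<inter> space (info P A X (enat n)) \<in> sets (info P A X (enat n))"
        by (rule measurable_sets) simp
    qed simp
    finally show ?thesis by (simp add: enat pred_def)
  qed simp
qed

text \<open>
  Stopping at \<open>n\<close> is a false alarm with conditional probability at most the posterior at time
  \<open>n\<close>, which is at most \<open>\<alpha>\<close> there. Summing over \<open>n\<close> gives the constraint.
\<close>

lemma T_RP_in_Delta:
  assumes "0 \<le> \<alpha>"
  shows "T_RP P A R X \<alpha> \<in> Delta P A t X \<alpha>"
proof -
  let ?T = "T_RP P A R X \<alpha>"
  note st = stopping_time_T_RP[of \<alpha>]
  let ?B = "\<lambda>n. {\<omega> \<in> space P. ?T \<omega> = enat n}"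
  let ?A = "\<lambda>n. {\<omega> \<in> space P. n < t \<omega>} \<inter> ?B n"
  note t_measurable[measurable] R_measurable[measurable]
  have BF: "?B n \<in> sets (info P A X (enat n))" for n
  proof (cases n)
    case 0
    then show ?thesis using stopping_time_sets[OF st, of 0] by (simp add: zero_enat_def[symmetric])
  next
    case (Suc j)
    have "e = enat n \<longleftrightarrow> e \<le> enat n \<and> \<not> e \<le> enat j" for e
      using Suc by (cases e) auto
    then have "?B n = {\<omega> \<in> space P. ?T \<omega> \<le> enat n} - {\<omega> \<in> space P. ?T \<omega> \<le> enat j}"
      by blast
    also have "\<dots> \<in> sets (info P A X (enat n))"
      using stopping_time_sets[OF st, of "enat n"] stopping_time_sets[OF st, of "enat j"] info_mono[of "enat j" "enat n"] Suc
      by (intro sets.Diff) auto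
    finally show ?thesis .
  qed
  then have B[measurable]: "?B n \<in> sets P" for n using sets_info_subset by blast
  have step: "prob (?A n) \<le> \<alpha> * prob (?B n)" for n
  proof -
    have "prob (?A n) \<le> prob ({\<omega> \<in> space P. R n \<omega> = 0} \<inter> ?B n)"
      using R_before by (intro finite_measure_mono) (blast, measurable)
    also have "\<dots> = (\<integral>\<omega>. indicator (?B n) \<omega> * post_no_change P A R X n \<omega> \<partial>P)" by (rule integral_post(1)[OF BF])
    also have "\<dots> \<le> (\<integral>\<omega>. indicator (?B n) \<omega> * \<alpha> \<partial>P)"
    proof (rule integral_mono[OF integral_post(2)[OF BF]])
      fix \<omega> 
      have *: "post_no_change P A R X n \<omega> \<le> \<alpha>" if "?T \<omega> = enat n"
      proof -
        obtain j where j: "j \<le> n" "post_no_change P A R X j \<omega> \<le> \<alpha>"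
          using T_RP_le_iff[of \<alpha> \<omega> n] \<open>?T \<omega> = enat n\<close> by auto
        then have "?T \<omega> \<le> enat j" using T_RP_le_iff by blast
        then have "j = n" using \<open>?T \<omega> = enat n\<close> j(1) by simp
        then show ?thesis using j by simp
      qed
      then show "indicator (?B n) \<omega> * post_no_change P A R X n \<omega> \<le> indicator (?B n) \<omega> * \<alpha>"
        by (cases "\<omega> \<in> ?B n") simp_all
    qed (use B in \<open>simp add: emeasure_eq_measure\<close>)
    also have "\<dots> = \<alpha> * prob (?B n)" by (simp add: Int_absorb2 sets.sets_into_space)
    finally show ?thesis .
  qed
  have "(\<lambda>n. prob (?A n)) sums prob (\<Union>n. ?A n)"
    by (intro finite_measure_UNION) (auto simp: disjoint_family_on_def)
  moreover have "(\<lambda>n. \<alpha> * prob (?B n)) sums (\<alpha> * prob (\<Union>n. ?B n))"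
    by (intro sums_mult finite_measure_UNION) (auto simp: disjoint_family_on_def)
  ultimately have "prob (\<Union>n. ?A n) \<le> \<alpha> * prob (\<Union>n. ?B n)"
    by (rule sums_le[OF step])
  also have "\<dots> \<le> \<alpha>" using assms by (simp add: mult_left_le)
  also have "(\<Union>n. ?A n) = {\<omega> \<in> space P. ?T \<omega> < enat (t \<omega>)}"
  proof -
    have "e < enat k \<longleftrightarrow> (\<exists>n. n < k \<and> e = enat n)" for e k by (cases e) auto
    then show ?thesis by blast
  qed
  finally show ?thesis using st by (simp add: Delta_def PFA_def)
qed

end

text \<open>
  Almost sure convergence implies convergence in probability.
\<close>

section \<open>The lower bound on the delay\<close>

lemma (in finite_measure) measure_tendsto_0_if_eventually_not:
  assumes [measurable]: "\<And>n. Measurable.pred M (pr n)"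
    and ev: "AE x in M. \<forall>\<^sub>F n in sequentially. \<not> pr n x"
  shows "(\<lambda>n. measure M {x \<in> space M. pr n x}) \<longlonglongrightarrow> 0"
proof -
  have "(\<lambda>n. \<integral>x. indicator {x \<in> space M. pr n x} x \<partial>M) \<longlonglongrightarrow> (\<integral>x. (0::real) \<partial>M)"
  proof (rule integral_dominated_convergence[where w="\<lambda>_. 1"])
    show "AE x in M. (\<lambda>n. indicator {x \<in> space M. pr n x} x :: real) \<longlonglongrightarrow> 0"
      using ev
    proof eventually_elim
      case (elim x)
      then have "\<forall>\<^sub>F n in sequentially. indicator {x \<in> space M. pr n x} x = (0 :: real)"
        by eventually_elim simp
      then show ?case by (rule tendsto_eventually)
    qed
  qed (auto simp: indicator_def)
  then show ?thesis by (simp add: Int_absorb2)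
qed

lemma abs_ln_at_top: "filterlim (\<lambda>\<alpha>::real. \<bar>ln \<alpha>\<bar>) at_top (at_right 0)"
  using filterlim_at_infinity_imp_norm_at_top[OF filterlim_at_bot_imp_at_infinity[OF ln_at_0]] by simp

locale llr_convergence = deterministic_event_model +
  fixes q :: "nat \<Rightarrow> real"
  assumes Z_conv: "\<And>m k. m < M \<Longrightarrow>
      AE \<omega> in P. t \<omega> = k \<and> Src \<omega> = src m \<longrightarrow>
        (\<lambda>n. Z A src f0 f1 X k m (k + n) \<omega> / ereal (real n)) \<longlonglongrightarrow> ereal (q m)"
begin

definition decay :: real where
  "decay = \<bar>ln (1 - \<rho>)\<bar>"

definition rate :: "nat \<Rightarrow> real" where
  "rate m = q m + decay"

lemma decay_pos: "0 < decay"
  using rho by (simp add: decay_def)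

text \<open>
  \<open>decay\<close> is the exponential rate at which the prior probability of no change vanishes; the posterior
  vanishes at this rate plus \<open>q m\<close>.
\<close>

lemma power_eq_exp_decay: "(1 - \<rho>) ^ n = exp (- decay * real n)"
proof -
  have "decay = - ln (1 - \<rho>)" using rho by (simp add: decay_def)
  then show ?thesis using rho by (simp add: exp_of_nat2_mult)
qed

lemma Z_affected_conv:
  assumes "m < M"
  shows "AE \<omega> in law k m. (\<lambda>n. Z_affected X k m (k + n) \<omega> / ereal (real n)) \<longlonglongrightarrow> ereal (q m)"
  unfolding AE_law_iff[OF assms]
  using Z_conv[OF assms, of k] AE_Z_eq_Z_affected[OF assms, of k]
  by eventually_elim (auto simp: cell_def)

lemma Z_affected_upper_tail:
  assumes "m < M" "q m < r"
  shows "(\<lambda>n. measure (law k m) {\<omega> \<in> space P. ereal (r * real n) < Z_affected X k m (k + n) \<omega>}) \<longlonglongrightarrow> 0"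
proof -
  interpret L: prob_space "law k m" by (rule prob_space_law[OF assms(1)])
  note Z_affected_measurable[OF assms(1), measurable]
  have "(\<lambda>n. measure (law k m) {\<omega> \<in> space (law k m). ereal (r * real n) < Z_affected X k m (k + n) \<omega>}) \<longlonglongrightarrow> 0"
  proof (rule L.measure_tendsto_0_if_eventually_not)
    show "AE \<omega> in law k m. \<forall>\<^sub>F n in sequentially. \<not> ereal (r * real n) < Z_affected X k m (k + n) \<omega>"
      using Z_affected_conv[OF assms(1), of k]
    proof eventually_elim
      case (elim \<omega>)
      then have "\<forall>\<^sub>F n in sequentially. Z_affected X k m (k + n) \<omega> / ereal (real n) < ereal r"
        using assms(2) by (auto intro: order_tendstoD)
      then show ?case using eventually_gt_at_top[of 0]
      proof eventually_elim
        case (elim n)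
        then show ?case
          by (cases "Z_affected X k m (k + n) \<omega>") (auto simp: pos_divide_less_eq not_less)
      qed
    qed
  qed measurable
  then show ?thesis by simp
qed

text \<open>
  If \<open>q m\<close> were negative, the statistic would fall below \<open>r n\<close> for some \<open>r < 0\<close> with probability
  tending to \<open>1\<close> under \<open>law 0 m\<close>. By change of measure that probability is at most \<open>exp (r n)\<close>. In
  particular the rates \<open>q m + decay\<close> are positive.
\<close>

lemma q_nonneg:
  assumes "m < M"
  shows "0 \<le> q m"
proof (rule ccontr)
  assume "\<not> 0 \<le> q m"
  (* Any r strictly between q m and 0. *)
  define r where "r = q m / 2"
  have r: "q m < r" "r < 0" using \<open>\<not> 0 \<le> q m\<close> by (auto simp: r_def)
  interpret L: prob_space "law 0 m" by (rule prob_space_law[OF assms])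
  note Z_affected_measurable[OF assms, measurable]
  let ?G = "\<lambda>n. {\<omega> \<in> space P. Z_affected X 0 m n \<omega> \<le> ereal (r * real n)}"
  have up: "(\<lambda>n. measure (law 0 m) {\<omega> \<in> space P. ereal (r * real n) < Z_affected X 0 m n \<omega>}) \<longlonglongrightarrow> 0"
    using Z_affected_upper_tail[OF assms r(1), of 0] by simp
  have "1 - measure (law 0 m) {\<omega> \<in> space P. ereal (r * real n) < Z_affected X 0 m n \<omega>} \<le> exp (r * real n)" for n
  proof -
    interpret L': prob_space "law (Suc n) m" by (rule prob_space_law[OF assms])
    have "(Z_affected X 0 m n -` {..ereal (r * real n)}) \<inter> space (info P A X (enat n)) \<in> sets (info P A X (enat n))"
      by (rule measurable_sets[OF Z_affected_info[OF assms]]) simp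
    then have G: "?G n \<in> sets (info P A X (enat n))" by (simp add: vimage_ray_Int)
    have "{\<omega> \<in> space P. ereal (r * real n) < Z_affected X 0 m n \<omega>} \<in> L.events" by simp
    from L.prob_compl[OF this]
    have "1 - measure (law 0 m) {\<omega> \<in> space P. ereal (r * real n) < Z_affected X 0 m n \<omega>}
      = measure (law 0 m) (space P - {\<omega> \<in> space P. ereal (r * real n) < Z_affected X 0 m n \<omega>})" by simp
    also have "space P - {\<omega> \<in> space P. ereal (r * real n) < Z_affected X 0 m n \<omega>} = ?G n" by auto
    also have "measure (law 0 m) (?G n) \<le> exp (r * real n) * measure (law (Suc n) m) (?G n)"
      by (rule change_le_no_change[OF assms assms lessI G]) simp
    also have "\<dots> \<le> exp (r * real n) * 1" by (intro mult_left_mono L'.prob_le_1) simp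
    finally show ?thesis by simp
  qed
  moreover have "(\<lambda>n. 1 - measure (law 0 m) {\<omega> \<in> space P. ereal (r * real n) < Z_affected X 0 m n \<omega>}) \<longlonglongrightarrow> 1 - 0"
    by (intro tendsto_intros up)
  moreover have "(\<lambda>n. exp (r * real n)) \<longlonglongrightarrow> 0"
  proof -
    have "(\<lambda>n. exp r ^ n) \<longlonglongrightarrow> 0" using r(2) by (intro LIMSEQ_power_zero) simp
    then show ?thesis by (simp add: exp_of_nat2_mult)
  qed
  ultimately have "1 - 0 \<le> (0 :: real)" by (intro LIMSEQ_le) auto
  then show False by simp
qed

lemma rate_pos: "m < M \<Longrightarrow> 0 < rate m"
  using q_nonneg[of m] decay_pos by (simp add: rate_def)

text \<open>
  A fraction \<open>1 - \<epsilon>\<close> of the first-order optimal delay for the source \<open>src m\<close>.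
\<close>

definition horizon :: "real \<Rightarrow> nat \<Rightarrow> real \<Rightarrow> nat" where
  "horizon \<epsilon> m \<alpha> = nat \<lfloor>(1 - \<epsilon>) * \<bar>ln \<alpha>\<bar> / rate m\<rfloor>"

lemma horizon_at_top:
  assumes "m < M" "\<epsilon> < 1"
  shows "filterlim (horizon \<epsilon> m) sequentially (at_right 0)"
proof -
  have "filterlim (\<lambda>\<alpha>. ((1 - \<epsilon>) / rate m) * \<bar>ln \<alpha>\<bar>) at_top (at_right 0)"
    using rate_pos[OF assms(1)] assms(2)
    by (intro filterlim_tendsto_pos_mult_at_top[OF tendsto_const _ abs_ln_at_top]) simp
  then have "filterlim (\<lambda>\<alpha>. nat \<lfloor>((1 - \<epsilon>) / rate m) * \<bar>ln \<alpha>\<bar>\<rfloor>) sequentially (at_right 0)"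
    by (intro filterlim_compose[OF filterlim_nat_sequentially] filterlim_compose[OF filterlim_floor_sequentially])
  then show ?thesis by (simp add: horizon_def[abs_def])
qed

text \<open>
  In \<open>stopped_early_bound\<close>, take \<open>N\<close> to be the horizon and \<open>c = (q m + \<epsilon> rate m) N\<close>. The first term vanishes
  because the statistic is about \<open>q m N\<close>. The exponent of the second is
  \<open>(1 + \<epsilon>) rate m N - \<bar>ln \<alpha>\<bar>\<close> up to a constant, and since \<open>rate m N \<le> (1 - \<epsilon>) \<bar>ln \<alpha>\<bar>\<close> it is at
  most \<open>- \<epsilon>\<^sup>2 \<bar>ln \<alpha>\<bar>\<close>. The bound does not depend on the rule.
\<close>

lemma stop_after_horizon:
  assumes "m < M" and \<epsilon>: "0 < \<epsilon>" "\<epsilon> < 1"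
  shows "\<forall>\<^sub>F \<alpha> in at_right 0. \<forall>T\<in>Delta P A t X \<alpha>.
    measure (law k m) {\<omega> \<in> space P. T \<omega> \<le> enat (k + horizon \<epsilon> m \<alpha>)} \<le> \<epsilon>"
proof -
  define r where "r = q m + \<epsilon> * rate m"
  note rp = rate_pos[OF assms(1)]
  define C where "C = real M / \<rho> * exp (decay * (real k + 1))"
  have C: "0 \<le> C" using rho by (simp add: C_def)
  have "((\<lambda>\<alpha>. measure (law k m) {\<omega> \<in> space P. ereal (r * real (horizon \<epsilon> m \<alpha>)) < Z_affected X k m (k + horizon \<epsilon> m \<alpha>) \<omega>}) \<longlongrightarrow> 0) (at_right 0)"
    using rp \<epsilon> by (intro filterlim_compose[OF Z_affected_upper_tail[OF assms(1)] horizon_at_top[OF assms(1)]]) (auto simp: r_def)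
  moreover have "((\<lambda>\<alpha>. C * exp (- (\<epsilon>^2 * \<bar>ln \<alpha>\<bar>))) \<longlongrightarrow> C * 0) (at_right 0)"
    using \<epsilon> by (intro tendsto_mult tendsto_const filterlim_compose[OF exp_at_bot]
        filterlim_uminus_at_bot_at_top[THEN filterlim_compose]
        filterlim_tendsto_pos_mult_at_top[OF tendsto_const _ abs_ln_at_top]) auto
  ultimately have lim: "((\<lambda>\<alpha>. measure (law k m) {\<omega> \<in> space P. ereal (r * real (horizon \<epsilon> m \<alpha>)) < Z_affected X k m (k + horizon \<epsilon> m \<alpha>) \<omega>}
      + C * exp (- (\<epsilon>^2 * \<bar>ln \<alpha>\<bar>))) \<longlongrightarrow> 0 + C * 0) (at_right 0)"
    by (rule tendsto_add)
  have "\<forall>\<^sub>F \<alpha> in at_right 0. measure (law k m) {\<omega> \<in> space P. ereal (r * real (horizon \<epsilon> m \<alpha>)) < Z_affected X k m (k + horizon \<epsilon> m \<alpha>) \<omega>}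
      + C * exp (- (\<epsilon>^2 * \<bar>ln \<alpha>\<bar>)) < \<epsilon>"
    using order_tendstoD(2)[OF lim, of \<epsilon>] \<epsilon> by simp
  moreover have "\<forall>\<^sub>F \<alpha> in at_right 0. (0::real) < \<alpha> \<and> \<alpha> < 1"
    by (rule eventually_mono[OF eventually_at_right_real[of 0 1]]) auto
  ultimately show ?thesis
  proof eventually_elim
    case (elim \<alpha>)
    define N where "N = horizon \<epsilon> m \<alpha>"
    have N: "real N \<le> (1 - \<epsilon>) * \<bar>ln \<alpha>\<bar> / rate m"
      unfolding N_def horizon_def using \<epsilon> rp by (intro of_nat_floor) simp
    have "rate m * real N \<le> (1 - \<epsilon>) * \<bar>ln \<alpha>\<bar>"
      using N rp by (simp add: field_simps)
    then have "(1 + \<epsilon>) * (rate m * real N) \<le> (1 + \<epsilon>) * ((1 - \<epsilon>) * \<bar>ln \<alpha>\<bar>)"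
      using \<epsilon> by (intro mult_left_mono) auto
    then have le: "r * real N + decay * real N \<le> \<bar>ln \<alpha>\<bar> - \<epsilon>^2 * \<bar>ln \<alpha>\<bar>"
      by (simp add: r_def rate_def algebra_simps power2_eq_square)
    have al: "\<alpha> = exp (- \<bar>ln \<alpha>\<bar>)" using elim by simp
    have "exp (r * real N) * (\<alpha> / weight (Suc (k + N))) = C * exp (r * real N + decay * real N - \<bar>ln \<alpha>\<bar>)"
    proof -
      have "1 / weight (Suc (k + N)) = real M / \<rho> * exp (decay * (real k + 1) + decay * real N)"
      proof -
        have "weight (Suc (k + N)) = \<rho> * exp (- (decay * (real k + 1) + decay * real N)) / real M"
          unfolding weight_def power_eq_exp_decay by (simp add: algebra_simps)
        then show ?thesis by (simp only: exp_minus) (simp add: divide_inverse mult_ac)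
      qed
      then have "exp (r * real N) * (exp (- \<bar>ln \<alpha>\<bar>) * (1 / weight (Suc (k + N)))) = C * exp (r * real N + decay * real N - \<bar>ln \<alpha>\<bar>)"
        by (simp only: C_def) (simp add: exp_add exp_diff exp_minus field_simps)
      then show ?thesis using al by simp
    qed
    also have "\<dots> \<le> C * exp (- (\<epsilon>^2 * \<bar>ln \<alpha>\<bar>))"
      using C le by (intro mult_left_mono) auto
    finally have b: "exp (r * real N) * (\<alpha> / weight (Suc (k + N))) \<le> C * exp (- (\<epsilon>^2 * \<bar>ln \<alpha>\<bar>))" .
    show ?case
    proof
      fix T assume T: "T \<in> Delta P A t X \<alpha>"
      from stopped_early_bound[OF T assms(1), of k "k + N" "r * real N"] b elim(1)
      show "measure (law k m) {\<omega> \<in> space P. T \<omega> \<le> enat (k + horizon \<epsilon> m \<alpha>)} \<le> \<epsilon>"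
        unfolding N_def by linarith
    qed
  qed
qed

lemma stopping_time_measurable:
  assumes "stopping_time (info P A X) T"
  shows "T \<in> borel_measurable P"
  by (rule measurable_stopping_time[OF assms sets_info_subset space_info])

lemma borel_measurable_delay:
  assumes "stopping_time (info P A X) T"
  shows "(\<lambda>\<omega>. ennreal_of_enat (T \<omega> - enat (t \<omega>))) \<in> borel_measurable P"
proof -
  have "T \<in> measurable P (count_space UNIV)"
    using stopping_time_measurable[OF assms]
    by (subst measurable_count_space_eq2_countable) (auto intro: measurable_sets)
  note this[measurable] t_measurable[measurable]
  show ?thesis by measurable
qed

text \<open>
  The first-order optimal delay is \<open>\<bar>ln \<alpha>\<bar> * mean_inverse_rate\<close>.
\<close>

definition mean_inverse_rate :: real where
  "mean_inverse_rate = 1 / real M * (\<Sum>m<M. 1 / rate m)"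

lemma sum_weight: "(\<Sum>k<K. weight k) = (1 - (1 - \<rho>) ^ K) / real M"
proof -
  have "(\<Sum>k<K. weight k) = (\<rho> / real M) * (\<Sum>k<K. (1 - \<rho>) ^ k)"
    by (simp add: weight_def sum_distrib_left)
  also have "(\<Sum>k<K. (1 - \<rho>) ^ k) = (1 - (1 - \<rho>) ^ K) / \<rho>"
    using rho by (subst sum_gp_strict) auto
  finally show ?thesis using rho by simp
qed

text \<open>
  Markov's inequality: a rule that has not stopped by \<open>k + N\<close> has delay at least \<open>N + 1\<close>.
\<close>

lemma delay_on_cell_ge:
  assumes st: "stopping_time (info P A X) T" and "m < M"
    and early: "measure (law k m) {\<omega> \<in> space P. T \<omega> \<le> enat (k + N)} \<le> \<epsilon>"
    and b: "0 \<le> b" "b \<le> real (Suc N)" and "\<epsilon> < 1"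
  shows "ennreal (weight k * (b * (1 - \<epsilon>)))
    \<le> (\<integral>\<^sup>+\<omega>. ennreal_of_enat (T \<omega> - enat (t \<omega>)) * indicator (cell k m) \<omega> \<partial>P)"
proof -
  interpret L: prob_space "law k m" by (rule prob_space_law[OF assms(2)])
  let ?E = "{\<omega> \<in> space P. T \<omega> \<le> enat (k + N)}"
  have E: "?E \<in> L.events"
    using stopping_time_sets[OF st, of "enat (k + N)"] sets_info_subset by auto
  have cE: "space P - ?E \<in> sets P" using E by auto
  have pc: "1 - \<epsilon> \<le> measure (law k m) (space P - ?E)"
    using L.prob_compl[OF E] early by simp
  have "ennreal (weight k * (b * (1 - \<epsilon>))) \<le> ennreal (weight k * (real (Suc N) * measure (law k m) (space P - ?E)))"
    using pc b \<open>\<epsilon> < 1\<close> weight_pos[of k] by (intro ennreal_leI mult_left_mono mult_mono) auto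
  also have "\<dots> = of_nat (Suc N) * (ennreal (weight k) * emeasure (law k m) (space P - ?E))"
    using weight_pos[of k]
    by (simp add: L.emeasure_eq_measure ennreal_mult measure_nonneg ennreal_of_nat_eq_real_of_nat mult_ac)
  also have "\<dots> = of_nat (Suc N) * emeasure P (cell k m \<inter> (space P - ?E))"
    by (simp only: emeasure_law[OF assms(2) cE])
  also have "\<dots> = (\<integral>\<^sup>+\<omega>. of_nat (Suc N) * indicator (cell k m \<inter> (space P - ?E)) \<omega> \<partial>P)"
    using cE by (subst nn_integral_cmult_indicator) auto
  also have "\<dots> \<le> (\<integral>\<^sup>+\<omega>. ennreal_of_enat (T \<omega> - enat (t \<omega>)) * indicator (cell k m) \<omega> \<partial>P)"
  proof (rule nn_integral_mono)
    fix \<omega> assume "\<omega> \<in> space P"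
    have "enat (Suc N) \<le> T \<omega> - enat k" if "\<not> T \<omega> \<le> enat (k + N)"
      using that by (cases "T \<omega>") auto
    then have "of_nat (Suc N) \<le> ennreal_of_enat (T \<omega> - enat k)" if "\<not> T \<omega> \<le> enat (k + N)"
      using that by (metis ennreal_of_enat_enat ennreal_of_enat_le_iff)
    then show "of_nat (Suc N) * indicator (cell k m \<inter> (space P - ?E)) \<omega>
      \<le> ennreal_of_enat (T \<omega> - enat (t \<omega>)) * indicator (cell k m) \<omega>"
      by (auto simp: indicator_def cell_def simp del: of_nat_Suc)
  qed
  finally show ?thesis .
qed

text \<open>
  The three factors \<open>1 - \<epsilon>\<close> pay for the horizon, for the probability of stopping before it, and for
  the change points beyond \<open>K\<close>. The latter are dropped so that only finitely many limits have to hold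
  simultaneously.
\<close>

lemma ADD_lower_bound:
  assumes \<epsilon>: "0 < \<epsilon>" "\<epsilon> < 1"
  shows "\<forall>\<^sub>F \<alpha> in at_right 0. \<forall>T\<in>Delta P A t X \<alpha>.
    ennreal ((1 - \<epsilon>) ^ 3 * (\<bar>ln \<alpha>\<bar> * mean_inverse_rate)) \<le> ADD P t T"
proof -
  have "(\<lambda>K. (1 - \<rho>) ^ K) \<longlonglongrightarrow> 0" using rho by (intro LIMSEQ_power_zero) auto
  then have "\<forall>\<^sub>F K in sequentially. (1 - \<rho>) ^ K < \<epsilon>" using \<epsilon>(1) by (rule order_tendstoD(2))
  then obtain K where K: "(1 - \<rho>) ^ K < \<epsilon>" by (auto simp: eventually_sequentially)
  have "\<forall>\<^sub>F \<alpha> in at_right 0. \<forall>p\<in>{..<M} \<times> {..<K}. \<forall>T\<in>Delta P A t X \<alpha>.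
    measure (law (snd p) (fst p)) {\<omega> \<in> space P. T \<omega> \<le> enat (snd p + horizon \<epsilon> (fst p) \<alpha>)} \<le> \<epsilon>"
    using stop_after_horizon[OF _ \<epsilon>] by (intro eventually_ball_finite) auto
  then show ?thesis
  proof eventually_elim
    case (elim \<alpha>)
    let ?b = "\<lambda>m. (1 - \<epsilon>) * \<bar>ln \<alpha>\<bar> / rate m"
    show ?case
    proof
      fix T assume T: "T \<in> Delta P A t X \<alpha>"
      then have st: "stopping_time (info P A X) T" by (simp add: Delta_def)
      let ?I = "\<lambda>m k. \<integral>\<^sup>+\<omega>. ennreal_of_enat (T \<omega> - enat (t \<omega>)) * indicator (cell k m) \<omega> \<partial>P"
      have b0: "0 \<le> ?b m" if "m < M" for m using \<epsilon> rate_pos[OF that] by simp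
      have cell: "ennreal (weight k * (?b m * (1 - \<epsilon>))) \<le> ?I m k" if "m < M" "k < K" for m k
      proof (rule delay_on_cell_ge[OF st that(1)])
        show "measure (law k m) {\<omega> \<in> space P. T \<omega> \<le> enat (k + horizon \<epsilon> m \<alpha>)} \<le> \<epsilon>"
          using elim[rule_format, of "(m, k)" T] that T by simp
        show "?b m \<le> real (Suc (horizon \<epsilon> m \<alpha>))"
          unfolding horizon_def by linarith
      qed (use b0[OF that(1)] \<epsilon> in auto)
      have "(1 - \<epsilon>) ^ 3 * (\<bar>ln \<alpha>\<bar> * mean_inverse_rate) = (\<Sum>m<M. (1 - \<epsilon>) / real M * (?b m * (1 - \<epsilon>)))"
        unfolding mean_inverse_rate_def sum_distrib_left
        by (intro sum.cong refl) (simp add: power3_eq_cube)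
      also have "\<dots> \<le> (\<Sum>m<M. (\<Sum>k<K. weight k) * (?b m * (1 - \<epsilon>)))"
        using K \<epsilon> b0 by (intro sum_mono mult_right_mono mult_nonneg_nonneg) (auto simp: sum_weight intro!: divide_right_mono)
      finally have "ennreal ((1 - \<epsilon>) ^ 3 * (\<bar>ln \<alpha>\<bar> * mean_inverse_rate))
        \<le> ennreal (\<Sum>m<M. \<Sum>k<K. weight k * (?b m * (1 - \<epsilon>)))"
        by (intro ennreal_leI) (simp only: sum_distrib_right)
      also have "\<dots> = (\<Sum>m<M. \<Sum>k<K. ennreal (weight k * (?b m * (1 - \<epsilon>))))"
      proof -
        have nn: "0 \<le> weight k * (?b m * (1 - \<epsilon>))" if "m < M" for k m
          using b0[OF that] \<epsilon> weight_pos[of k] by (intro mult_nonneg_nonneg) auto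
        have "ennreal (\<Sum>m<M. \<Sum>k<K. weight k * (?b m * (1 - \<epsilon>)))
          = (\<Sum>m<M. ennreal (\<Sum>k<K. weight k * (?b m * (1 - \<epsilon>))))"
          by (intro sum_ennreal[symmetric] sum_nonneg nn) simp
        also have "\<dots> = (\<Sum>m<M. \<Sum>k<K. ennreal (weight k * (?b m * (1 - \<epsilon>))))"
          by (intro sum.cong refl sum_ennreal[symmetric] nn) simp
        finally show ?thesis .
      qed
      also have "\<dots> \<le> (\<Sum>m<M. \<Sum>k<K. ?I m k)"
        using cell by (intro sum_mono) auto
      also have "\<dots> \<le> (\<Sum>m<M. \<Sum>k. ?I m k)"
        by (intro sum_mono sum_le_suminf summableI) auto
      also have "\<dots> = ADD P t T"
        unfolding ADD_def by (rule nn_integral_cells[OF borel_measurable_delay[OF st], symmetric])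
      finally show "ennreal ((1 - \<epsilon>) ^ 3 * (\<bar>ln \<alpha>\<bar> * mean_inverse_rate)) \<le> ADD P t T" .
    qed
  qed
qed

end

lemma ennreal_of_enat_Q:
  "ennreal_of_enat (Q B src f0 f1 Y q \<epsilon> k m \<omega>) =
    (SUP n. if 1 \<le> n \<and> ereal \<epsilon> < \<bar>Z B src f0 f1 Y k m (k + n - 1) \<omega> / ereal (real n) - ereal (q m)\<bar>
      then of_nat n else 0)"
proof (rule antisym)
  show "ennreal_of_enat (Q B src f0 f1 Y q \<epsilon> k m \<omega>) \<le>
    (SUP n. if 1 \<le> n \<and> ereal \<epsilon> < \<bar>Z B src f0 f1 Y k m (k + n - 1) \<omega> / ereal (real n) - ereal (q m)\<bar>
      then of_nat n else 0)"
    unfolding Q_def ennreal_of_enat_Sup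
  proof (rule SUP_least, safe)
    fix n assume "1 \<le> n" "ereal \<epsilon> < \<bar>Z B src f0 f1 Y k m (k + n - 1) \<omega> / ereal (real n) - ereal (q m)\<bar>"
    then show "ennreal_of_enat (enat n) \<le> (SUP n. if 1 \<le> n \<and> ereal \<epsilon> < \<bar>Z B src f0 f1 Y k m (k + n - 1) \<omega> / ereal (real n) - ereal (q m)\<bar>
      then of_nat n else 0)"
      by (intro SUP_upper2[of n]) auto
  qed
  show "(SUP n. if 1 \<le> n \<and> ereal \<epsilon> < \<bar>Z B src f0 f1 Y k m (k + n - 1) \<omega> / ereal (real n) - ereal (q m)\<bar>
      then of_nat n else 0) \<le> ennreal_of_enat (Q B src f0 f1 Y q \<epsilon> k m \<omega>)"
    unfolding Q_def ennreal_of_enat_Sup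
    by (rule SUP_least) (auto intro!: SUP_upper2[of "enat _"])
qed

lemma Q_outside:
  assumes "Q B src f0 f1 Y q \<epsilon> k m \<omega> < enat n" "1 \<le> n"
  shows "\<bar>Z B src f0 f1 Y k m (k + n - 1) \<omega> / ereal (real n) - ereal (q m)\<bar> \<le> ereal \<epsilon>"
proof (rule ccontr)
  assume "\<not> ?thesis"
  then have "enat n \<le> Q B src f0 f1 Y q \<epsilon> k m \<omega>"
    unfolding Q_def using assms(2) by (intro Sup_upper) auto
  with assms(1) show False by simp
qed

lemma (in deterministic_event_model) borel_measurable_Q:
  assumes "m < M" "\<And>i. B i \<subseteq> A i"
    and "\<And>i a. 1 \<le> i \<Longrightarrow> a \<in> B i \<Longrightarrow> Y i a \<in> borel_measurable N"
  shows "(\<lambda>\<omega>. ennreal_of_enat (Q B src f0 f1 Y q \<epsilon> k m \<omega>)) \<in> borel_measurable N"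
proof -
  have [measurable]: "Z B src f0 f1 Y k m n \<in> borel_measurable N" for n
    by (rule borel_measurable_Z[OF assms(1,2)]) (rule assms(3))
  show ?thesis unfolding ennreal_of_enat_Q by measurable
qed

text \<open>
  The shape in which the bounds on the delay arise: an additive constant that may blow up as \<open>\<theta>\<close> tends to \<open>0\<close>
  is still negligible against \<open>L\<close> for each fixed \<open>\<theta>\<close>.
\<close>

section \<open>The upper bound on the delay of the posterior rule\<close>

lemma tendsto_ratio_of_bounds:
  fixes V L :: "'b \<Rightarrow> real"
  assumes L_top: "filterlim L at_top F"
    and lower: "\<And>\<epsilon>. 0 < \<epsilon> \<Longrightarrow> \<epsilon> < 1 \<Longrightarrow> \<forall>\<^sub>F x in F. (1 - \<epsilon>) ^ 3 * L x \<le> V x"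
    and upper: "\<And>\<theta>. 0 < \<theta> \<Longrightarrow> \<theta> < 1 \<Longrightarrow>
      \<exists>C. \<forall>\<^sub>F x in F. V x \<le> C + L x / (1 - \<theta>)"
  shows "((\<lambda>x. V x / L x) \<longlongrightarrow> 1) F"
proof (rule order_tendstoI)
  have L: "\<forall>\<^sub>F x in F. 0 < L x"
    using L_top by (simp add: filterlim_at_top_dense)
  {
    fix a :: real assume "a < 1"
    have "((\<lambda>\<epsilon>::real. (1 - \<epsilon>) ^ 3) \<longlongrightarrow> (1 - 0) ^ 3) (at_right 0)" by (intro tendsto_intros)
    then have "\<forall>\<^sub>F \<epsilon> in at_right 0. a < (1 - \<epsilon>) ^ 3" using \<open>a < 1\<close> by (intro order_tendstoD) auto
    moreover have "\<forall>\<^sub>F \<epsilon>::real in at_right 0. 0 < \<epsilon> \<and> \<epsilon> < 1"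
      by (rule eventually_mono[OF eventually_at_right_real[of 0 1]]) auto
    ultimately have "\<forall>\<^sub>F \<epsilon> in at_right 0. a < (1 - \<epsilon>) ^ 3 \<and> 0 < \<epsilon> \<and> \<epsilon> < 1" by (rule eventually_conj)
    then obtain \<epsilon> where \<epsilon>: "a < (1 - \<epsilon>) ^ 3" "0 < \<epsilon>" "\<epsilon> < 1"
      using eventually_happens'[OF trivial_limit_at_right_real] by blast
    show "\<forall>\<^sub>F x in F. a < V x / L x"
      using lower[OF \<epsilon>(2,3)] L
    proof eventually_elim
      case (elim x)
      have "a * L x < (1 - \<epsilon>) ^ 3 * L x" using \<epsilon>(1) elim(2) by (rule mult_strict_right_mono)
      then have "a * L x < V x" using elim(1) by (rule less_le_trans)
      then show ?case using elim(2) by (simp add: pos_less_divide_eq)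
    qed
  }
  {
    fix a :: real assume "1 < a"
    (* Any \<theta> with 1 / (1 - \<theta>) < a will do; this one gives 1 / (1 - \<theta>) = 2 a / (a + 1). *)
    define \<theta> where "\<theta> = (a - 1) / (2 * a)"
    have \<theta>: "0 < \<theta>" "\<theta> < 1" "1 / (1 - \<theta>) < a"
      using \<open>1 < a\<close> by (auto simp: \<theta>_def field_simps)
    obtain C where C: "\<forall>\<^sub>F x in F. V x \<le> C + L x / (1 - \<theta>)" using upper[OF \<theta>(1,2)] by blast
    have "\<forall>\<^sub>F x in F. C / (a - 1 / (1 - \<theta>)) < L x"
      using L_top by (simp add: filterlim_at_top_dense)
    then show "\<forall>\<^sub>F x in F. V x / L x < a"
      using C L
    proof eventually_elim
      case (elim x)
      have "C < L x * (a - 1 / (1 - \<theta>))" using elim(1) \<theta>(3) by (simp only: pos_divide_less_eq diff_gt_0_iff_gt)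
      then have "C + L x / (1 - \<theta>) < a * L x" by (simp add: algebra_simps)
      then have "V x < a * L x" using elim(2) by (rule le_less_trans[rotated])
      then show ?case using elim(3) by (simp add: pos_divide_less_eq)
    qed
  }
qed

locale llr_quick_convergence = llr_convergence +
  assumes Q_summable: "\<And>\<epsilon> m. 0 < \<epsilon> \<Longrightarrow> m < M \<Longrightarrow>
      (\<Sum>j. ennreal \<P>(\<omega> in P. t \<omega> = Suc j) *
        (\<integral>\<^sup>+\<omega>. ennreal_of_enat (Q A src f0 f1 X q \<epsilon> (Suc j) m \<omega>)
          \<partial>uniform_measure P {\<omega> \<in> space P. t \<omega> = Suc j})) < \<infinity>"
begin

abbreviation Q_affected :: "real \<Rightarrow> nat \<Rightarrow> nat \<Rightarrow> 'a \<Rightarrow> enat" where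
  "Q_affected \<epsilon> k m \<equiv> Q (affected k m) src f0 f1 X q \<epsilon> k m"

lemma Q_affected_measurable [measurable]:
  "m < M \<Longrightarrow> (\<lambda>\<omega>. ennreal_of_enat (Q_affected \<epsilon> k m \<omega>)) \<in> borel_measurable P"
  using affected_subset[of k m] X_measurable by (intro borel_measurable_Q) auto

text \<open>
  The hypothesis on \<open>Q\<close> conditions on the change point only, not on the source, and therefore bounds the
  contribution of each single source.
\<close>

lemma Q_affected_cell_integral_le:
  assumes "m < M"
  shows "(\<integral>\<^sup>+\<omega>. ennreal_of_enat (Q_affected \<epsilon> k m \<omega>) * indicator (cell k m) \<omega> \<partial>P)
    \<le> ennreal \<P>(\<omega> in P. t \<omega> = k) *
      (\<integral>\<^sup>+\<omega>. ennreal_of_enat (Q A src f0 f1 X q \<epsilon> k m \<omega>) \<partial>uniform_measure P {\<omega> \<in> space P. t \<omega> = k})"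
proof -
  note t_measurable[measurable]
  let ?E = "{\<omega> \<in> space P. t \<omega> = k}"
  have Qm: "(\<lambda>\<omega>. ennreal_of_enat (Q A src f0 f1 X q \<epsilon> k m \<omega>)) \<in> borel_measurable P"
    using X_measurable by (intro borel_measurable_Q[OF assms]) auto
  have E: "emeasure P ?E = ennreal \<P>(\<omega> in P. t \<omega> = k)" by (simp add: emeasure_eq_measure)
  have pos: "0 < \<P>(\<omega> in P. t \<omega> = k)" using t_geometric[of k] rho by simp
  have "(\<integral>\<^sup>+\<omega>. ennreal_of_enat (Q_affected \<epsilon> k m \<omega>) * indicator (cell k m) \<omega> \<partial>P)
    \<le> (\<integral>\<^sup>+\<omega>. ennreal_of_enat (Q A src f0 f1 X q \<epsilon> k m \<omega>) * indicator ?E \<omega> \<partial>P)"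
  proof (rule nn_integral_mono_AE)
    show "AE \<omega> in P. ennreal_of_enat (Q_affected \<epsilon> k m \<omega>) * indicator (cell k m) \<omega>
      \<le> ennreal_of_enat (Q A src f0 f1 X q \<epsilon> k m \<omega>) * indicator ?E \<omega>"
      using AE_Z_eq_Z_affected[OF assms, of k]
      by eventually_elim (auto simp: indicator_def cell_def Q_def)
  qed
  also have "\<dots> = ennreal \<P>(\<omega> in P. t \<omega> = k) *
      ((\<integral>\<^sup>+\<omega>. ennreal_of_enat (Q A src f0 f1 X q \<epsilon> k m \<omega>) * indicator ?E \<omega> \<partial>P) / emeasure P ?E)"
    unfolding E using pos
    by (simp add: mult.commute[of "ennreal _"] ennreal_divide_times ennreal_mult_divide_eq)
  also have "\<dots> = ennreal \<P>(\<omega> in P. t \<omega> = k) *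
      (\<integral>\<^sup>+\<omega>. ennreal_of_enat (Q A src f0 f1 X q \<epsilon> k m \<omega>) \<partial>uniform_measure P ?E)"
    using Qm by (subst nn_integral_uniform_measure) auto
  finally show ?thesis .
qed

lemma Q_affected_cells_summable:
  assumes "0 < \<epsilon>" "m < M"
  shows "(\<Sum>j. \<integral>\<^sup>+\<omega>. ennreal_of_enat (Q_affected \<epsilon> (Suc j) m \<omega>) * indicator (cell (Suc j) m) \<omega> \<partial>P) < \<infinity>"
  using Q_affected_cell_integral_le[OF assms(2)]
  by (intro le_less_trans[OF suminf_le Q_summable[OF assms]]) auto

text \<open>
  A sensor affected under change point \<open>k\<close> is affected under any earlier one, so the sensors that
  enter \<open>Q_affected \<epsilon> k m\<close> have independent observations with densities \<open>f1\<close> under both laws. This is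
  an identity of laws of whole observation sequences, hence the infinite index set.
\<close>

lemma Q_affected_integral_shift:
  assumes "m < M" "j \<le> k"
  shows "(\<integral>\<^sup>+\<omega>. ennreal_of_enat (Q_affected \<epsilon> k m \<omega>) \<partial>law j m) = (\<integral>\<^sup>+\<omega>. ennreal_of_enat (Q_affected \<epsilon> k m \<omega>) \<partial>law k m)"
proof -
  let ?J = "SIGMA i:{1..}. affected k m i"
  let ?h = "\<lambda>x. ennreal_of_enat (Q (affected k m) src f0 f1 (\<lambda>i a x. x (i, a)) q \<epsilon> k m x)"
  have J: "?J \<subseteq> (SIGMA i:{1..}. A i)" using affected_subset by blast
  have h: "?h \<in> borel_measurable (PiM ?J (\<lambda>_. borel))"
    by (intro borel_measurable_Q[OF assms(1)] affected_subset measurable_component_singleton) auto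
  have eq: "ennreal_of_enat (Q_affected \<epsilon> k m \<omega>) = ?h (obs ?J \<omega>)" for \<omega>
  proof -
    have "Z_affected (\<lambda>i a x. x (i, a)) k m n (obs ?J \<omega>) = Z_affected X k m n \<omega>" for n
      by (rule Z_affected_obs) auto
    then show ?thesis by (simp only: Q_def)
  qed
  have int: "(\<integral>\<^sup>+\<omega>. ennreal_of_enat (Q_affected \<epsilon> k m \<omega>) \<partial>law l m)
    = (\<integral>\<^sup>+x. ?h x \<partial>distr (law l m) (PiM ?J (\<lambda>_. borel)) (obs ?J))" for l
    unfolding eq using h obs_measurable[OF J]
    by (subst nn_integral_distr) (auto simp: measurable_cong_sets[OF sets_law refl])
  have "obs_density j m (fst p) (snd p) x = obs_density k m (fst p) (snd p) x" if "p \<in> ?J" for p x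
    using that assms(2) by (auto simp: obs_density_def affected_def eta_def)
  then have "PiM ?J (\<lambda>p. density lborel (\<lambda>x. ennreal (obs_density j m (fst p) (snd p) x)))
    = PiM ?J (\<lambda>p. density lborel (\<lambda>x. ennreal (obs_density k m (fst p) (snd p) x)))"
    by (intro PiM_cong refl) simp
  then show ?thesis unfolding int distr_obs[OF assms(1) J] by simp
qed

text \<open>
  The index \<open>max 1 k\<close> replaces the change point \<open>0\<close>, about which the summability hypothesis is silent,
  by \<open>1\<close>; the term \<open>k = 0\<close> is finite because its integrand has the same law as in the term \<open>k = 1\<close>.
\<close>

lemma total_overshoot_finite:
  assumes "0 < \<epsilon>" "m < M"
  shows "(\<Sum>k. \<integral>\<^sup>+\<omega>. ennreal_of_enat (Q_affected \<epsilon> (max 1 k) m \<omega>) * indicator (cell k m) \<omega> \<partial>P) < \<infinity>"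
proof -
  let ?I = "\<lambda>k. \<integral>\<^sup>+\<omega>. ennreal_of_enat (Q_affected \<epsilon> (max 1 k) m \<omega>) * indicator (cell k m) \<omega> \<partial>P"
  have S: "(\<Sum>j. ?I (Suc j)) < \<infinity>" using Q_affected_cells_summable[OF assms] by simp
  have "?I 1 \<le> (\<Sum>j. ?I (Suc j))"
    using sum_le_suminf[of "\<lambda>j. ?I (Suc j)" "{0}"] by simp
  then have "?I 1 < \<infinity>" using S by (rule le_less_trans)
  then have "ennreal (weight 1) * (\<integral>\<^sup>+\<omega>. ennreal_of_enat (Q_affected \<epsilon> 1 m \<omega>) \<partial>law 1 m) < \<infinity>"
    using nn_integral_law[OF assms(2), of "\<lambda>\<omega>. ennreal_of_enat (Q_affected \<epsilon> 1 m \<omega>)" 1] assms(2) by simp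
  then have "(\<integral>\<^sup>+\<omega>. ennreal_of_enat (Q_affected \<epsilon> 1 m \<omega>) \<partial>law 0 m) < \<infinity>"
    using Q_affected_integral_shift[OF assms(2), of 0 1 \<epsilon>] by (auto simp: ennreal_mult_less_top)
  then have "ennreal (weight 0) * (\<integral>\<^sup>+\<omega>. ennreal_of_enat (Q_affected \<epsilon> 1 m \<omega>) \<partial>law 0 m) < \<infinity>"
    by (simp add: ennreal_mult_less_top)
  then have "?I 0 < \<infinity>"
    using nn_integral_law[OF assms(2), of "\<lambda>\<omega>. ennreal_of_enat (Q_affected \<epsilon> 1 m \<omega>)" 0] assms(2) by simp
  then show ?thesis using S
    by (subst suminf_offset[of _ 1]) (auto simp: summableI)
qed

text \<open>
  The number of observations after which the bound on the posterior falls below \<open>\<alpha>\<close> if the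
  statistic grows at the rate \<open>q m - \<epsilon>\<close>.
\<close>

definition delay_bound :: "real \<Rightarrow> nat \<Rightarrow> real \<Rightarrow> real" where
  "delay_bound \<epsilon> m \<alpha> = (\<bar>ln \<alpha>\<bar> + ln (real M / \<rho>)) / (rate m - \<epsilon>)"

lemma delay_bound_nonneg: "\<epsilon> < rate m \<Longrightarrow> 0 \<le> delay_bound \<epsilon> m \<alpha>"
  using rho M_pos by (simp add: delay_bound_def divide_nonneg_pos)

text \<open>
  This holds almost surely on the whole space, not only where the change point is \<open>k\<close>: the bound on the
  posterior by the statistic of \<open>k\<close> is valid for every outcome. Only thus can change point \<open>0\<close> be handled
  through \<open>k = 1\<close>.
\<close>

lemma T_RP_upper_bound:
  assumes "m < M" "\<epsilon> < rate m" "0 < \<alpha>" "\<alpha> < 1" "1 \<le> k"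
  shows "AE \<omega> in P. T_RP P A R X \<alpha> \<omega> \<le> enat k + Q_affected \<epsilon> k m \<omega> + enat (nat \<lfloor>delay_bound \<epsilon> m \<alpha>\<rfloor>)"
proof -
  let ?b = "delay_bound \<epsilon> m \<alpha>"
  have "AE \<omega> in P. ereal ((q m - \<epsilon>) * real N) \<le> Z_affected X k m (k + N - 1) \<omega> \<longrightarrow> post_no_change P A R X (k + N - 1) \<omega> \<le> \<alpha>"
    if "?b < real N" for N
  proof (rule post_le_if_large_Z[OF assms(1)])
    have "\<bar>ln \<alpha>\<bar> + ln (real M / \<rho>) < (rate m - \<epsilon>) * real N"
      using that assms(2) by (simp add: delay_bound_def pos_divide_less_eq mult.commute)
    then have "exp (- ((rate m - \<epsilon>) * real N)) < exp (- \<bar>ln \<alpha>\<bar> - ln (real M / \<rho>))" by simp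
    also have "\<dots> = \<alpha> * (\<rho> / real M)"
      using assms(3,4) rho M_pos by (simp add: exp_diff)
    finally have "(1 - \<rho>) ^ k * exp (- ((rate m - \<epsilon>) * real N)) < (1 - \<rho>) ^ k * (\<alpha> * (\<rho> / real M))"
      using rho by (intro mult_strict_left_mono) auto
    also have "\<dots> = \<alpha> * weight k" by (simp add: weight_def)
    also have "(1 - \<rho>) ^ k * exp (- ((rate m - \<epsilon>) * real N)) = (1 - \<rho>) ^ Suc (k + N - 1) * exp (- ((q m - \<epsilon>) * real N))"
      using assms(5) unfolding power_eq_exp_decay by (simp add: rate_def algebra_simps flip: exp_add)
    finally show "(1 - \<rho>) ^ Suc (k + N - 1) * exp (- ((q m - \<epsilon>) * real N)) < \<alpha> * weight k" .
  qed
  then have "AE \<omega> in P. \<forall>N. ?b < real N \<longrightarrow> ereal ((q m - \<epsilon>) * real N) \<le> Z_affected X k m (k + N - 1) \<omega> \<longrightarrow>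
    post_no_change P A R X (k + N - 1) \<omega> \<le> \<alpha>"
    by (subst AE_all_countable) auto
  then show ?thesis
  proof eventually_elim
    case (elim \<omega>)
    show ?case
    proof (cases "Q_affected \<epsilon> k m \<omega>")
      case (enat s)
      (* The least N beyond both the last exceptional time s and the bound. *)
      define N where "N = Suc (max s (nat \<lfloor>?b\<rfloor>))"
      have b: "?b < real N" unfolding N_def by linarith
      have "\<bar>Z_affected X k m (k + N - 1) \<omega> / ereal (real N) - ereal (q m)\<bar> \<le> ereal \<epsilon>"
        using enat by (intro Q_outside) (auto simp: N_def)
      then have "ereal ((q m - \<epsilon>) * real N) \<le> Z_affected X k m (k + N - 1) \<omega>"
        by (cases "Z_affected X k m (k + N - 1) \<omega>") (auto simp: N_def abs_le_iff field_simps simp del: of_nat_Suc)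
      then have "post_no_change P A R X (k + N - 1) \<omega> \<le> \<alpha>" using elim b by blast
      then have "T_RP P A R X \<alpha> \<omega> \<le> enat (k + N - 1)" using T_RP_le_iff by blast
      also have "\<dots> \<le> enat (k + s + nat \<lfloor>?b\<rfloor>)" by (auto simp: N_def)
      finally show ?thesis using enat by simp
    qed simp
  qed
qed

lemma suminf_weight: "(\<Sum>k. ennreal (weight k)) = ennreal (1 / real M)"
proof -
  have "(\<lambda>k. \<rho> / real M * (1 - \<rho>) ^ k) sums (\<rho> / real M * (1 / (1 - (1 - \<rho>))))"
    using rho by (intro sums_mult geometric_sums) auto
  then have "weight sums (1 / real M)" using rho by (simp add: weight_def[abs_def] mult_ac)
  then show ?thesis using weight_pos by (intro suminf_ennreal_eq) (auto simp: less_imp_le)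
qed

text \<open>
  The additional \<open>1\<close> covers change point \<open>0\<close>, where the delay is counted from \<open>0\<close> but bounded through \<open>k = 1\<close>.
\<close>

lemma delay_T_RP_on_cells:
  assumes "m < M" "\<epsilon> < rate m" "0 < \<alpha>" "\<alpha> < 1"
  shows "(\<Sum>k. \<integral>\<^sup>+\<omega>. ennreal_of_enat (T_RP P A R X \<alpha> \<omega> - enat (t \<omega>)) * indicator (cell k m) \<omega> \<partial>P)
    \<le> (\<Sum>k. \<integral>\<^sup>+\<omega>. ennreal_of_enat (Q_affected \<epsilon> (max 1 k) m \<omega>) * indicator (cell k m) \<omega> \<partial>P)
      + ennreal ((delay_bound \<epsilon> m \<alpha> + 1) / real M)"
proof -
  let ?b = "delay_bound \<epsilon> m \<alpha>"
  let ?I = "\<lambda>k. \<integral>\<^sup>+\<omega>. ennreal_of_enat (Q_affected \<epsilon> (max 1 k) m \<omega>) * indicator (cell k m) \<omega> \<partial>P"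
  note Q_affected_measurable[OF assms(1), measurable]
  have b: "0 \<le> ?b" by (rule delay_bound_nonneg[OF assms(2)])
  have "(\<integral>\<^sup>+\<omega>. ennreal_of_enat (T_RP P A R X \<alpha> \<omega> - enat (t \<omega>)) * indicator (cell k m) \<omega> \<partial>P)
    \<le> ?I k + ennreal (weight k) * ennreal (?b + 1)" for k
  proof -
    have "(\<integral>\<^sup>+\<omega>. ennreal_of_enat (T_RP P A R X \<alpha> \<omega> - enat (t \<omega>)) * indicator (cell k m) \<omega> \<partial>P)
      \<le> (\<integral>\<^sup>+\<omega>. ennreal_of_enat (Q_affected \<epsilon> (max 1 k) m \<omega>) * indicator (cell k m) \<omega> + ennreal (?b + 1) * indicator (cell k m) \<omega> \<partial>P)"
    proof (rule nn_integral_mono_AE)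
      show "AE \<omega> in P. ennreal_of_enat (T_RP P A R X \<alpha> \<omega> - enat (t \<omega>)) * indicator (cell k m) \<omega>
        \<le> ennreal_of_enat (Q_affected \<epsilon> (max 1 k) m \<omega>) * indicator (cell k m) \<omega> + ennreal (?b + 1) * indicator (cell k m) \<omega>"
        using T_RP_upper_bound[OF assms, of "max 1 k", OF max.cobounded1]
      proof eventually_elim
        case (elim \<omega>)
        show ?case
        proof (cases "\<omega> \<in> cell k m")
          case True
          let ?B = "nat \<lfloor>?b\<rfloor>"
          have "T_RP P A R X \<alpha> \<omega> - enat k \<le> Q_affected \<epsilon> (max 1 k) m \<omega> + enat (Suc ?B)"
            using elim by (cases "T_RP P A R X \<alpha> \<omega>"; cases "Q_affected \<epsilon> (max 1 k) m \<omega>") auto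
          then have "ennreal_of_enat (T_RP P A R X \<alpha> \<omega> - enat k) \<le> ennreal_of_enat (Q_affected \<epsilon> (max 1 k) m \<omega> + enat (Suc ?B))"
            by (simp only: ennreal_of_enat_le_iff)
          also have "\<dots> = ennreal_of_enat (Q_affected \<epsilon> (max 1 k) m \<omega>) + ennreal (real (Suc ?B))"
            by (simp only: ennreal_of_enat_plus ennreal_of_enat_enat ennreal_of_nat_eq_real_of_nat)
          also have "\<dots> \<le> ennreal_of_enat (Q_affected \<epsilon> (max 1 k) m \<omega>) + ennreal (?b + 1)"
            using b by (intro add_left_mono ennreal_leI) linarith
          finally show ?thesis using True by (simp add: cell_def)
        qed simp
      qed
    qed
    also have "\<dots> = ?I k + ennreal (?b + 1) * emeasure P (cell k m)"
      by (subst nn_integral_add) (auto simp: nn_integral_cmult_indicator)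
    finally show ?thesis by (simp add: emeasure_cell[OF assms(1)] mult.commute)
  qed
  then have "(\<Sum>k. \<integral>\<^sup>+\<omega>. ennreal_of_enat (T_RP P A R X \<alpha> \<omega> - enat (t \<omega>)) * indicator (cell k m) \<omega> \<partial>P)
    \<le> (\<Sum>k. ?I k + ennreal (weight k) * ennreal (?b + 1))"
    by (intro suminf_le summableI)
  also have "\<dots> = (\<Sum>k. ?I k) + (\<Sum>k. ennreal (weight k)) * ennreal (?b + 1)"
    by (subst suminf_add[symmetric]) (auto simp: summableI)
  also have "(\<Sum>k. ennreal (weight k)) * ennreal (?b + 1) = ennreal ((?b + 1) / real M)"
    unfolding suminf_weight using b by (subst ennreal_mult[symmetric]) auto
  finally show ?thesis .
qed

text \<open>
  Taking \<open>\<epsilon>\<close> proportional to the rate of each source makes the loss the same factor \<open>1 / (1 - \<theta>)\<close> for all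
  of them.
\<close>

lemma ADD_T_RP_upper_bound:
  assumes \<theta>: "0 < \<theta>" "\<theta> < 1"
  obtains C where "\<And>\<alpha>. 0 < \<alpha> \<Longrightarrow> \<alpha> < 1 \<Longrightarrow>
    ADD P t (T_RP P A R X \<alpha>) \<le> ennreal (C + \<bar>ln \<alpha>\<bar> * mean_inverse_rate / (1 - \<theta>))"
proof -
  let ?\<epsilon> = "\<lambda>m. \<theta> * rate m"
  have \<epsilon>: "0 < ?\<epsilon> m" "?\<epsilon> m < rate m" if "m < M" for m
    using \<theta> rate_pos[OF that] by auto
  let ?K = "\<lambda>m. \<Sum>k. \<integral>\<^sup>+\<omega>. ennreal_of_enat (Q_affected (?\<epsilon> m) (max 1 k) m \<omega>) * indicator (cell k m) \<omega> \<partial>P"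
  define K where "K m = enn2real (?K m)" for m
  have K: "?K m = ennreal (K m)" if "m < M" for m
    using total_overshoot_finite[OF \<epsilon>(1)[OF that] that] by (simp add: K_def)
  have K0: "0 \<le> K m" for m by (simp add: K_def)
  define C where "C = (\<Sum>m<M. K m + (ln (real M / \<rho>) / (rate m - ?\<epsilon> m) + 1) / real M)"
  show ?thesis
  proof
    fix \<alpha> :: real assume \<alpha>: "0 < \<alpha>" "\<alpha> < 1"
    let ?T = "T_RP P A R X \<alpha>"
    have "ADD P t ?T = (\<Sum>m<M. \<Sum>k. \<integral>\<^sup>+\<omega>. ennreal_of_enat (?T \<omega> - enat (t \<omega>)) * indicator (cell k m) \<omega> \<partial>P)"
      unfolding ADD_def by (rule nn_integral_cells[OF borel_measurable_delay[OF stopping_time_T_RP]])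
    also have "\<dots> \<le> (\<Sum>m<M. ennreal (K m + (delay_bound (?\<epsilon> m) m \<alpha> + 1) / real M))"
    proof (rule sum_mono)
      fix m assume "m \<in> {..<M}"
      then have m: "m < M" by simp
      show "(\<Sum>k. \<integral>\<^sup>+\<omega>. ennreal_of_enat (?T \<omega> - enat (t \<omega>)) * indicator (cell k m) \<omega> \<partial>P)
        \<le> ennreal (K m + (delay_bound (?\<epsilon> m) m \<alpha> + 1) / real M)"
        using delay_T_RP_on_cells[OF m \<epsilon>(2)[OF m] \<alpha>] K[OF m] K0[of m] delay_bound_nonneg[OF \<epsilon>(2)[OF m], of \<alpha>]
        by (simp add: ennreal_plus)
    qed
    also have "\<dots> = ennreal (\<Sum>m<M. K m + (delay_bound (?\<epsilon> m) m \<alpha> + 1) / real M)"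
      using K0 delay_bound_nonneg[OF \<epsilon>(2), of _ \<alpha>] by (intro sum_ennreal add_nonneg_nonneg) auto
    also have "(\<Sum>m<M. K m + (delay_bound (?\<epsilon> m) m \<alpha> + 1) / real M)
      = (\<Sum>m<M. (K m + (ln (real M / \<rho>) / (rate m - ?\<epsilon> m) + 1) / real M) + \<bar>ln \<alpha>\<bar> / (rate m - ?\<epsilon> m) / real M)"
      by (intro sum.cong refl) (simp add: delay_bound_def add_divide_distrib)
    also have "\<dots> = C + (\<Sum>m<M. \<bar>ln \<alpha>\<bar> / (rate m - ?\<epsilon> m) / real M)"
      by (simp only: sum.distrib C_def)
    also have "(\<Sum>m<M. \<bar>ln \<alpha>\<bar> / (rate m - ?\<epsilon> m) / real M) = \<bar>ln \<alpha>\<bar> * mean_inverse_rate / (1 - \<theta>)"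
      unfolding mean_inverse_rate_def sum_distrib_left sum_divide_distrib
    proof (intro sum.cong refl)
      fix m assume "m \<in> {..<M}"
      have "rate m - ?\<epsilon> m = rate m * (1 - \<theta>)" by (simp add: algebra_simps)
      then show "\<bar>ln \<alpha>\<bar> / (rate m - ?\<epsilon> m) / real M = \<bar>ln \<alpha>\<bar> * (1 / real M * (1 / rate m)) / (1 - \<theta>)"
        by simp
    qed
    finally show "ADD P t ?T \<le> ennreal (C + \<bar>ln \<alpha>\<bar> * mean_inverse_rate / (1 - \<theta>))" .
  qed
qed

lemma mean_inverse_rate_pos: "0 < mean_inverse_rate"
  unfolding mean_inverse_rate_def using M_pos rate_pos
  by (intro mult_pos_pos sum_pos) (auto simp: lessThan_empty_iff)

lemma first_order_delay_at_top:
  "filterlim (\<lambda>\<alpha>. \<bar>ln \<alpha>\<bar> * mean_inverse_rate) at_top (at_right 0)"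
  using filterlim_tendsto_pos_mult_at_top[OF tendsto_const mean_inverse_rate_pos abs_ln_at_top]
  by (simp add: mult.commute)

definition optimal_delay :: "real \<Rightarrow> ennreal" where
  "optimal_delay \<alpha> = (INF T \<in> Delta P A t X \<alpha>. ADD P t T)"

lemma optimal_delay_le_T_RP: "0 \<le> \<alpha> \<Longrightarrow> optimal_delay \<alpha> \<le> ADD P t (T_RP P A R X \<alpha>)"
  unfolding optimal_delay_def by (intro INF_lower T_RP_in_Delta)

lemma ADD_T_RP_finite: "0 < \<alpha> \<Longrightarrow> \<alpha> < 1 \<Longrightarrow> ADD P t (T_RP P A R X \<alpha>) < \<top>"
proof -
  assume \<alpha>: "0 < \<alpha>" "\<alpha> < 1"
  obtain C where "\<And>\<alpha>. 0 < \<alpha> \<Longrightarrow> \<alpha> < 1 \<Longrightarrow>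
      ADD P t (T_RP P A R X \<alpha>) \<le> ennreal (C + \<bar>ln \<alpha>\<bar> * mean_inverse_rate / (1 - 1 / 2))"
    by (rule ADD_T_RP_upper_bound[of "1 / 2"]) auto
  from this[OF \<alpha>] show ?thesis by (rule le_less_trans) simp
qed

text \<open>
  The optimal delay lies between the lower bound, which holds for every rule in \<open>Delta\<close>, and the delay of the
  posterior rule, which is one of them.
\<close>

lemma ADD_T_RP_asymptotic:
  "((\<lambda>\<alpha>. enn2real (ADD P t (T_RP P A R X \<alpha>)) / (\<bar>ln \<alpha>\<bar> * mean_inverse_rate)) \<longlongrightarrow> 1) (at_right 0)"
  "((\<lambda>\<alpha>. enn2real (optimal_delay \<alpha>) / (\<bar>ln \<alpha>\<bar> * mean_inverse_rate)) \<longlongrightarrow> 1) (at_right 0)"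
proof -
  have \<alpha>: "\<forall>\<^sub>F \<alpha>::real in at_right 0. 0 < \<alpha> \<and> \<alpha> < 1"
    by (rule eventually_mono[OF eventually_at_right_real[of 0 1]]) auto
  have fin: "optimal_delay \<alpha> < \<top>" if "0 < \<alpha>" "\<alpha> < 1" for \<alpha>
    using optimal_delay_le_T_RP[of \<alpha>] ADD_T_RP_finite[OF that] that by auto
  have low: "\<forall>\<^sub>F \<alpha> in at_right 0. ennreal ((1 - \<epsilon>) ^ 3 * (\<bar>ln \<alpha>\<bar> * mean_inverse_rate)) \<le> optimal_delay \<alpha>"
    if "0 < \<epsilon>" "\<epsilon> < 1" for \<epsilon>
    using ADD_lower_bound[OF that] by eventually_elim (auto simp: optimal_delay_def intro!: INF_greatest)
  have nn: "0 \<le> (1 - \<epsilon>) ^ 3 * (\<bar>ln \<alpha>\<bar> * mean_inverse_rate)" if "\<epsilon> < 1" for \<epsilon> \<alpha>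
    using that mean_inverse_rate_pos by simp
  have up: "\<exists>C. \<forall>\<^sub>F \<alpha> in at_right 0. enn2real (ADD P t (T_RP P A R X \<alpha>)) \<le> C + \<bar>ln \<alpha>\<bar> * mean_inverse_rate / (1 - \<theta>)"
    if \<theta>: "0 < \<theta>" "\<theta> < 1" for \<theta>
  proof -
    obtain C where C: "\<And>\<alpha>. 0 < \<alpha> \<Longrightarrow> \<alpha> < 1 \<Longrightarrow>
      ADD P t (T_RP P A R X \<alpha>) \<le> ennreal (C + \<bar>ln \<alpha>\<bar> * mean_inverse_rate / (1 - \<theta>))"
      using ADD_T_RP_upper_bound[OF \<theta>] by blast
    have "enn2real (ADD P t (T_RP P A R X \<alpha>)) \<le> max 0 C + \<bar>ln \<alpha>\<bar> * mean_inverse_rate / (1 - \<theta>)"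
      if "0 < \<alpha>" "\<alpha> < 1" for \<alpha>
    proof (rule enn2real_leI)
      show "0 \<le> max 0 C + \<bar>ln \<alpha>\<bar> * mean_inverse_rate / (1 - \<theta>)"
        using mean_inverse_rate_pos \<theta> by (intro add_nonneg_nonneg divide_nonneg_pos) auto
      show "ADD P t (T_RP P A R X \<alpha>) \<le> ennreal (max 0 C + \<bar>ln \<alpha>\<bar> * mean_inverse_rate / (1 - \<theta>))"
        by (rule order_trans[OF C[OF that]]) (auto intro!: ennreal_leI)
    qed
    then show ?thesis using \<alpha> by (intro exI[of _ "max 0 C"]) (auto elim: eventually_mono)
  qed
  show "((\<lambda>\<alpha>. enn2real (optimal_delay \<alpha>) / (\<bar>ln \<alpha>\<bar> * mean_inverse_rate)) \<longlongrightarrow> 1) (at_right 0)"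
  proof (rule tendsto_ratio_of_bounds[OF first_order_delay_at_top])
    fix \<epsilon> :: real assume \<epsilon>: "0 < \<epsilon>" "\<epsilon> < 1"
    show "\<forall>\<^sub>F \<alpha> in at_right 0. (1 - \<epsilon>) ^ 3 * (\<bar>ln \<alpha>\<bar> * mean_inverse_rate) \<le> enn2real (optimal_delay \<alpha>)"
      using low[OF \<epsilon>] \<alpha>
    proof eventually_elim
      case (elim \<alpha>)
      then show ?case using fin[of \<alpha>] nn[OF \<epsilon>(2), of \<alpha>] by (cases "optimal_delay \<alpha>") (auto simp: ennreal_le_iff)
    qed
  next
    fix \<theta> :: real assume \<theta>: "0 < \<theta>" "\<theta> < 1"
    obtain C where C: "\<forall>\<^sub>F \<alpha> in at_right 0. enn2real (ADD P t (T_RP P A R X \<alpha>)) \<le> C + \<bar>ln \<alpha>\<bar> * mean_inverse_rate / (1 - \<theta>)"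
      using up[OF \<theta>] by blast
    have "\<forall>\<^sub>F \<alpha> in at_right 0. enn2real (optimal_delay \<alpha>) \<le> C + \<bar>ln \<alpha>\<bar> * mean_inverse_rate / (1 - \<theta>)"
      using C \<alpha>
    proof eventually_elim
      case (elim \<alpha>)
      then show ?case
        using enn2real_mono[OF optimal_delay_le_T_RP[of \<alpha>] ADD_T_RP_finite[of \<alpha>]] by linarith
    qed
    then show "\<exists>C. \<forall>\<^sub>F \<alpha> in at_right 0. enn2real (optimal_delay \<alpha>) \<le> C + \<bar>ln \<alpha>\<bar> * mean_inverse_rate / (1 - \<theta>)" ..
  qed
  show "((\<lambda>\<alpha>. enn2real (ADD P t (T_RP P A R X \<alpha>)) / (\<bar>ln \<alpha>\<bar> * mean_inverse_rate)) \<longlongrightarrow> 1) (at_right 0)"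
  proof (rule tendsto_ratio_of_bounds[OF first_order_delay_at_top _ up])
    fix \<epsilon> :: real assume \<epsilon>: "0 < \<epsilon>" "\<epsilon> < 1"
    show "\<forall>\<^sub>F \<alpha> in at_right 0. (1 - \<epsilon>) ^ 3 * (\<bar>ln \<alpha>\<bar> * mean_inverse_rate) \<le> enn2real (ADD P t (T_RP P A R X \<alpha>))"
      using low[OF \<epsilon>] \<alpha>
    proof eventually_elim
      case (elim \<alpha>)
      then have "ennreal ((1 - \<epsilon>) ^ 3 * (\<bar>ln \<alpha>\<bar> * mean_inverse_rate)) \<le> ADD P t (T_RP P A R X \<alpha>)"
        using optimal_delay_le_T_RP[of \<alpha>] by (meson less_imp_le order_trans)
      then show ?case using ADD_T_RP_finite[of \<alpha>] elim nn[OF \<epsilon>(2), of \<alpha>]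
        by (cases "ADD P t (T_RP P A R X \<alpha>)") (auto simp: ennreal_le_iff)
    qed
  qed
qed

end

section \<open>First-order optimality\<close>

theorem theorem4:
  fixes P :: "'w measure" and S :: "point set" and M :: nat and src :: "nat \<Rightarrow> point"
    and A :: "nat \<Rightarrow> point set"
    and f0 :: "real \<Rightarrow> real" and f1 :: "point \<Rightarrow> point \<Rightarrow> real \<Rightarrow> real"
    and \<rho> \<rho>1 :: real
    and Src :: "'w \<Rightarrow> point" and t :: "'w \<Rightarrow> nat" and R :: "nat \<Rightarrow> 'w \<Rightarrow> nat"
    and X :: "nat \<Rightarrow> point \<Rightarrow> 'w \<Rightarrow> real"
    and q :: "nat \<Rightarrow> real"
  assumes model: "event_model P S M src A f0 f1 \<rho> \<rho>1 Src t R X"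
    and deterministic_growth: "\<rho>1 = 1"
    and Z_conv: "\<And>m k. m < M \<Longrightarrow>
      AE \<omega> in P. t \<omega> = k \<and> Src \<omega> = src m \<longrightarrow>
        (\<lambda>n. Z A src f0 f1 X k m (k + n) \<omega> / ereal (real n)) \<longlonglongrightarrow> ereal (q m)"
    and Q_summable: "\<And>\<epsilon> m. 0 < \<epsilon> \<Longrightarrow> m < M \<Longrightarrow>
      (\<Sum>j. ennreal \<P>(\<omega> in P. t \<omega> = Suc j) *
        (\<integral>\<^sup>+\<omega>. ennreal_of_enat (Q A src f0 f1 X q \<epsilon> (Suc j) m \<omega>)
          \<partial>uniform_measure P {\<omega> \<in> space P. t \<omega> = Suc j})) < \<infinity>"
  shows "((\<lambda>\<alpha>. (INF T \<in> Delta P A t X \<alpha>. ADD P t T) / ADD P t (T_RP P A R X \<alpha>)) \<longlongrightarrow> 1) (at_right 0)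
    \<and> (\<exists>e :: real \<Rightarrow> real. (e \<longlongrightarrow> 0) (at_right 0) \<and>
        (\<forall>\<alpha>\<in>{0<..<1}. (INF T \<in> Delta P A t X \<alpha>. ADD P t T) =
          ennreal (1 / real M * (\<Sum>m<M. \<bar>ln \<alpha>\<bar> / (q m + \<bar>ln (1 - \<rho>)\<bar>)) * (1 + e \<alpha>))))"
proof -
  interpret event_model P S M src A f0 f1 \<rho> \<rho>1 Src t R X by (rule model)
  interpret llr_quick_convergence P S M src A f0 f1 \<rho> \<rho>1 Src t R X q
    by unfold_locales (fact deterministic_growth Z_conv Q_summable)+
  let ?V = "\<lambda>\<alpha>. ADD P t (T_RP P A R X \<alpha>)" and ?L = "\<lambda>\<alpha>. \<bar>ln \<alpha>\<bar> * mean_inverse_rate"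
  define e where "e \<alpha> = enn2real (optimal_delay \<alpha>) / ?L \<alpha> - 1" for \<alpha>
  have \<alpha>: "\<forall>\<^sub>F \<alpha>::real in at_right 0. 0 < \<alpha> \<and> \<alpha> < 1"
    by (rule eventually_mono[OF eventually_at_right_real[of 0 1]]) auto
  have fin: "optimal_delay \<alpha> < \<top>" if "0 < \<alpha>" "\<alpha> < 1" for \<alpha>
    using optimal_delay_le_T_RP[of \<alpha>] ADD_T_RP_finite[OF that] that by auto
  have Lpos: "0 < ?L \<alpha>" if "0 < \<alpha>" "\<alpha> < 1" for \<alpha>
    using that by (intro mult_pos_pos mean_inverse_rate_pos) simp
  have "((\<lambda>\<alpha>. enn2real (optimal_delay \<alpha>) / ?L \<alpha> / (enn2real (?V \<alpha>) / ?L \<alpha>)) \<longlongrightarrow> 1 / 1) (at_right 0)"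
    by (intro tendsto_divide ADD_T_RP_asymptotic) simp
  then have "((\<lambda>\<alpha>. ennreal (enn2real (optimal_delay \<alpha>) / ?L \<alpha> / (enn2real (?V \<alpha>) / ?L \<alpha>))) \<longlongrightarrow> ennreal (1 / 1)) (at_right 0)"
    by (rule tendsto_ennrealI)
  moreover have "\<forall>\<^sub>F \<alpha> in at_right 0.
    ennreal (enn2real (optimal_delay \<alpha>) / ?L \<alpha> / (enn2real (?V \<alpha>) / ?L \<alpha>)) = optimal_delay \<alpha> / ?V \<alpha>"
    using \<alpha> order_tendstoD(1)[OF ADD_T_RP_asymptotic(1), of 0, OF zero_less_one]
  proof eventually_elim
    case (elim \<alpha>)
    then have L: "0 < ?L \<alpha>" using Lpos by blast
    then have "0 * ?L \<alpha> < enn2real (?V \<alpha>)" using elim(2) by (simp only: pos_less_divide_eq)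
    then have "0 < enn2real (?V \<alpha>)" by simp
    moreover have "ennreal (enn2real (optimal_delay \<alpha>)) = optimal_delay \<alpha>" "ennreal (enn2real (?V \<alpha>)) = ?V \<alpha>"
      using fin[of \<alpha>] ADD_T_RP_finite[of \<alpha>] elim by simp_all
    moreover have "enn2real (optimal_delay \<alpha>) / ?L \<alpha> / (enn2real (?V \<alpha>) / ?L \<alpha>) = enn2real (optimal_delay \<alpha>) / enn2real (?V \<alpha>)"
    proof -
      have "x / l / (y / l) = x / y" if "0 < l" for x y l :: real using that by simp
      then show ?thesis using L by blast
    qed
    ultimately show ?case by (metis divide_ennreal enn2real_nonneg)
  qed
  ultimately have "((\<lambda>\<alpha>. optimal_delay \<alpha> / ?V \<alpha>) \<longlongrightarrow> 1) (at_right 0)"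
    by (simp add: tendsto_cong)
  moreover have "(e \<longlongrightarrow> 0) (at_right 0)"
    using tendsto_diff[OF ADD_T_RP_asymptotic(2) tendsto_const[of 1]] by (simp add: e_def[abs_def])
  moreover have "optimal_delay \<alpha> = ennreal (1 / real M * (\<Sum>m<M. \<bar>ln \<alpha>\<bar> / (q m + \<bar>ln (1 - \<rho>)\<bar>)) * (1 + e \<alpha>))"
    if "\<alpha> \<in> {0<..<1}" for \<alpha>
  proof -
    have "1 / real M * (\<Sum>m<M. \<bar>ln \<alpha>\<bar> / (q m + \<bar>ln (1 - \<rho>)\<bar>)) = ?L \<alpha>"
      by (simp add: mean_inverse_rate_def rate_def decay_def sum_distrib_left mult_ac)
    moreover have "?L \<alpha> * (1 + e \<alpha>) = enn2real (optimal_delay \<alpha>)"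
    proof -
      have "l * (1 + (x / l - 1)) = x" if "0 < l" for x l :: real using that by simp
      then show ?thesis unfolding e_def using Lpos[of \<alpha>] that by auto
    qed
    ultimately show ?thesis using fin[of \<alpha>] that by simp
  qed
  ultimately show ?thesis unfolding optimal_delay_def by blast
qed

end
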